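(* For any $r,t \in \mathbb{N}$ such that $r > t$, there exists $K = K(r,t)>0$ such that the following holds for every $n \in \mathbb{N}$. If $\mathcal{F} \subset S_n$ is $(t-1)$-intersection-free with $|\mathcal{F}| \geq K(n-t-1)!$, then there exists a $t$-star $\mathcal{G} \subset S_n$ such that $|\mathcal{F} \setminus \mathcal{G}| \leq K(n-r)!$.
   Context: $S_n$ denotes the symmetric group on $[n]=\{1,2,\ldots,n\}$. A family $\mathcal{F} \subset S_n$ is $(t-1)$-intersection-free if for any two distinct $\sigma,\tau \in \mathcal{F}$ we have $|\{i \in [n] : \sigma(i)=\tau(i)\}| \neq t-1$. A $t$-star in $S_n$ is a family of the form $\{\sigma \in S_n : \sigma(j)=\pi(j)\ \forall j \in S\}$, where $\pi : S \to T$ is a bijection between two $t$-element subsets $S,T$ of $[n]$. Convention: $m! := 1$ for negative integers $m$. *)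

theory Defs
  imports Complex_Main "HOL-Combinatorics.Permutations"
begin

definition Sym :: "nat \<Rightarrow> (nat \<Rightarrow> nat) set" where
  "Sym n = {\<sigma>. \<sigma> permutes {1..n}}"

(* The forbidden size s is an integer so that s = t - 1 involves no truncated
   subtraction; for t = 0 the condition is vacuous. *)
definition intersection_free :: "nat \<Rightarrow> int \<Rightarrow> (nat \<Rightarrow> nat) set \<Rightarrow> bool" where
  "intersection_free n s F \<longleftrightarrow>
     (\<forall>\<sigma>\<in>F. \<forall>\<tau>\<in>F. \<sigma> \<noteq> \<tau> \<longrightarrow> int (card {i \<in> {1..n}. \<sigma> i = \<tau> i}) \<noteq> s)"

definition is_star :: "nat \<Rightarrow> nat \<Rightarrow> (nat \<Rightarrow> nat) set \<Rightarrow> bool" where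
  "is_star n t G \<longleftrightarrow>
     (\<exists>S T \<pi>. S \<subseteq> {1..n} \<and> T \<subseteq> {1..n} \<and> card S = t \<and> card T = t \<and> bij_betw \<pi> S T \<and>
        G = {\<sigma> \<in> Sym n. \<forall>j\<in>S. \<sigma> j = \<pi> j})"

(* Convention: m! = 1 for negative m. *)
definition ext_fact :: "int \<Rightarrow> real" where
  "ext_fact m = (if m < 0 then 1 else fact (nat m))"

end

theory Submission
  imports Defs "HOL-Real_Asymp.Real_Asymp" "HOL-Analysis.Convex"
begin

text \<open>
  Permutations are identified with their graphs, which are \<^term>\<open>n\<close>-element subsets of the grid
  \<open>[n] \<times> [n]\<close>; agreement of two permutations becomes intersection of two sets, and a
  \<open>t\<close>-star consists of the graphs that contain a fixed \<open>t\<close>-element set. Only large \<open>n\<close> matters,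
  since for bounded \<open>n\<close> the constant \<open>K\<close> can be taken larger than \<open>n!\<close>. For
  \<open>t = 0\<close> the whole symmetric group is a star, so let \<open>t \<ge> 1\<close>. Let \<open>m = t - 1\<close> be the
  forbidden intersection size, \<open>b = n\<close> to the power \<open>1 / (2 m + 5)\<close>, and \<open>R = n / b\<close>.

  A family \<open>B\<close> of sets that contain \<open>S\<close> is called \<open>R\<close>-spread over \<open>S\<close> if fixing a further set of
  \<open>k\<close> points costs a factor of at least \<open>R ^ k\<close>. Call \<open>S\<close> a generator of the given family if some
  subfamily that is not too small is spread over \<open>S\<close>. A family with more than \<open>(n - r)!\<close> members
  always contains such a subfamily: take \<open>S\<close> that maximises \<open>|A[S]| R ^ |S|\<close>, where \<open>A[S]\<close> consists
  of the members that contain \<open>S\<close> (\<open>obtain_spread_restriction\<close>).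
  As \<open>R\<close> is \<open>n\<close> to a power that is smaller than one by a constant, the size of \<open>S\<close> is bounded in
  terms of \<open>r\<close> and \<open>t\<close> (\<open>restriction_size_le\<close>). Therefore all but \<open>(n - r)!\<close> members of the family
  contain a generator.

  The heart of the proof is that any two generators \<open>S\<close>, \<open>S'\<close> share at least \<open>t\<close> points
  (\<open>obtain_exact_intersection\<close>). If they shared at most \<open>m\<close>, one could first add common points
  to both, one at a time, until they share exactly \<open>m\<close>; this is possible because a family of
  permutations of polynomial density uses, in almost every row, more than two thirds of the entries
  at worst \<open>b\<close> times less often than the average permutation does (\<open>obtain_common_heavy_entry\<close>). Then one finds a member over \<open>S\<close> and a member over \<open>S'\<close>
  that are disjoint elsewhere. For this the grid is coloured randomly with four colours. A spread
  family has, with probability more than a half, a member that outside \<open>S\<close> uses only the first two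
  colours, and the same holds over \<open>S'\<close> with the other two colours.

  That random colouring statement is a version of the spread lemma that is behind recent sunflower
  bounds. Because \<open>R\<close> is as large as \<open>n / b\<close>, two rounds suffice. In each round, the second moment
  method in \<open>sum_card_stuck_le\<close> shows that for almost all members \<open>P\<close> there is a member whose part
  outside the revealed colour class is a small subset of \<open>P\<close>. The first round cuts the sizes from
  \<open>n\<close> to \<open>b\<^sup>2\<close>, which is much smaller than \<open>R\<close>, and the second round cuts them to \<open>0\<close>.

  Finally, if the pairwise \<open>t\<close>-intersecting generators have a common \<open>t\<close>-element subset, then it
  defines the desired star. Otherwise every generator contains one of boundedly many sets of size
  \<open>t + 1\<close> (\<open>card_covered_by_intersecting_generators_le\<close>), so that the family has only
  \<open>O((n - t - 1)!)\<close> members.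
\<close>

section \<open>Random colourings and the second moment method\<close>

text \<open>
  The set \<open>W\<close> is the part of the ground set revealed so far, and \<open>s i' - W\<close> is what is still missing
  from \<open>s i'\<close>. An index \<open>i\<close> makes progress if something of size less than \<open>j\<close> inside its own set
  would complete some member of the family; it is stuck otherwise. It is essential that \<open>i'\<close> may differ
  from \<open>i\<close> while the missing part lies inside \<open>s i\<close>: the missing parts then inherit the spreadness
  of the family.
\<close>

definition stuck :: "('i \<Rightarrow> 'a set) \<Rightarrow> 'i set \<Rightarrow> nat \<Rightarrow> 'a set \<Rightarrow> 'i set" where
  "stuck s I j W = {i \<in> I. \<forall>i'\<in>I. s i' - W \<subseteq> s i \<longrightarrow> j \<le> card (s i' - W)}"

abbreviation colour_class :: "'a set \<Rightarrow> ('a \<Rightarrow> 'c) \<Rightarrow> 'c \<Rightarrow> 'a set" where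
  "colour_class X f a \<equiv> {x \<in> X. f x = a}"

lemma card_colourings_containing:
  assumes "finite X" "finite C" "a \<in> C" "S \<subseteq> X"
  shows "card {g \<in> X \<rightarrow>\<^sub>E C. S \<subseteq> colour_class X g a} = card C ^ (card X - card S)"
proof -
  have "{g \<in> X \<rightarrow>\<^sub>E C. S \<subseteq> colour_class X g a} = (\<Pi>\<^sub>E x\<in>X. if x \<in> S then {a} else C)"
    using assms by (fastforce simp: PiE_iff extensional_def split: if_splits)
  then have "card {g \<in> X \<rightarrow>\<^sub>E C. S \<subseteq> colour_class X g a} = (\<Prod>x\<in>X. card (if x \<in> S then {a} else C))"
    using assms by (simp add: card_PiE)
  also have "\<dots> = (\<Prod>x\<in>X - S. card C)"
    using assms(1) by (intro prod.mono_neutral_cong_right) auto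
  also have "\<dots> = card C ^ (card X - card S)"
    using assms by (simp add: card_Diff_subset finite_subset)
  finally show ?thesis .
qed

text \<open>
  Recolouring all of \<open>s i\<close> with \<open>a\<close> forgets at most \<open>card C ^ card (s i)\<close> possibilities. If \<open>i\<close> is stuck
  for \<open>f\<close>, then after recolouring every member \<open>s i'\<close> of the class of \<open>a\<close> overlaps \<open>s i\<close> in
  at least \<open>j\<close> points, because what \<open>s i'\<close> was missing must have been supplied by \<open>s i\<close>. The gain is that the
  recoloured condition no longer involves \<open>f\<close>.
\<close>

lemma card_stuck_colourings_le:
  fixes a :: 'c and s :: "'i \<Rightarrow> 'a set"
  assumes fin: "finite X" "finite C" "a \<in> C" and S: "\<And>i. i \<in> I \<Longrightarrow> s i \<subseteq> X" and i: "i \<in> I"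
  shows "card {f \<in> X \<rightarrow>\<^sub>E C. i \<in> stuck s I j (colour_class X f a)}
    \<le> card C ^ card (s i) * card {g \<in> X \<rightarrow>\<^sub>E C. s i \<subseteq> colour_class X g a \<and>
        (\<forall>i'\<in>I. s i' \<subseteq> colour_class X g a \<longrightarrow> j \<le> card (s i \<inter> s i'))}"
    (is "card ?F \<le> _ * card ?G")
proof -
  define h where "h f = (restrict f (s i), \<lambda>x. if x \<in> s i then a else f x)" for f :: "'a \<Rightarrow> 'c"
  have fs: "finite (s i)" using S[OF i] fin finite_subset by blast
  have "inj_on h ?F"
  proof (rule inj_onI)
    fix f f' assume "h f = h f'"
    then have *: "restrict f (s i) = restrict f' (s i)"
      "(\<lambda>x. if x \<in> s i then a else f x) = (\<lambda>x. if x \<in> s i then a else f' x)"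
      by (auto simp: h_def)
    show "f = f'"
    proof
      fix x show "f x = f' x"
        using fun_cong[OF *(1), of x] fun_cong[OF *(2), of x] by (cases "x \<in> s i") auto
    qed
  qed
  moreover have "h ` ?F \<subseteq> (s i \<rightarrow>\<^sub>E C) \<times> ?G"
  proof
    fix y assume "y \<in> h ` ?F"
    then obtain f where f: "f \<in> X \<rightarrow>\<^sub>E C" "i \<in> stuck s I j (colour_class X f a)" and y: "y = h f"
      by auto
    define g where "g = (\<lambda>x. if x \<in> s i then a else f x)"
    have "restrict f (s i) \<in> s i \<rightarrow>\<^sub>E C" using f(1) S[OF i] by (auto simp: PiE_iff)
    moreover have "g \<in> X \<rightarrow>\<^sub>E C" using f(1) S[OF i] fin(3) by (auto simp: g_def PiE_iff extensional_def)
    moreover have "s i \<subseteq> colour_class X g a" using S[OF i] by (auto simp: g_def)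
    moreover have "j \<le> card (s i \<inter> s i')" if i': "i' \<in> I" "s i' \<subseteq> colour_class X g a" for i'
    proof -
      have sub: "s i' - colour_class X f a \<subseteq> s i \<inter> s i'"
        using i' S[OF i'(1)] by (fastforce simp: g_def split: if_splits)
      then have "j \<le> card (s i' - colour_class X f a)"
        using f(2) i' by (auto simp: stuck_def)
      also have "\<dots> \<le> card (s i \<inter> s i')" using sub fs by (intro card_mono) auto
      finally show ?thesis .
    qed
    ultimately show "y \<in> (s i \<rightarrow>\<^sub>E C) \<times> ?G" by (auto simp: y h_def g_def)
  qed
  moreover have "finite (X \<rightarrow>\<^sub>E C)" "finite (s i \<rightarrow>\<^sub>E C)"
    using fin fs by (simp_all add: finite_PiE)
  then have "finite ((s i \<rightarrow>\<^sub>E C) \<times> ?G)" by simp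
  ultimately have "card ?F \<le> card ((s i \<rightarrow>\<^sub>E C) \<times> ?G)" by (rule card_inj_on_le)
  also have "\<dots> = card C ^ card (s i) * card ?G"
    using fs by (simp add: card_cartesian_product card_funcsetE)
  finally show ?thesis .
qed

text \<open>
  The second moment argument. For a recoloured \<open>g\<close>, let \<open>Z g\<close> be the indices of members inside the class of
  \<open>a\<close> that overlap every such member in at least \<open>j\<close> points. Any two elements of \<open>Z g\<close> overlap in at
  least \<open>j\<close> points, so that the square of the weight of \<open>Z g\<close> is bounded by a sum over pairs with large overlap.
  By the Cauchy-Schwarz inequality the total weight over all \<open>g\<close> is controlled by the average of these
  squares, and in that average a pair with overlap \<open>k\<close> contributes \<open>card C ^ k\<close>.
\<close>

lemma sum_card_stuck_le:
  assumes fin: "finite X" "finite I" "finite C" "a \<in> C" and S: "\<And>i. i \<in> I \<Longrightarrow> s i \<subseteq> X"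
  shows "real (\<Sum>f\<in>X \<rightarrow>\<^sub>E C. card (stuck s I j (colour_class X f a)))
    \<le> real (card C) ^ card X *
      sqrt (\<Sum>i\<in>I. \<Sum>i'\<in>{i'\<in>I. j \<le> card (s i \<inter> s i')}. real (card C) ^ card (s i \<inter> s i'))"
    (is "real ?L \<le> _")
proof -
  define c where "c = real (card C)"
  define \<Omega> where "\<Omega> = X \<rightarrow>\<^sub>E C"
  define Z where "Z g = {i \<in> I. s i \<subseteq> colour_class X g a \<and>
        (\<forall>i'\<in>I. s i' \<subseteq> colour_class X g a \<longrightarrow> j \<le> card (s i \<inter> s i'))}" for g
  \<comment> \<open>The weight of i is the number of colourings that the recolouring of its set identifies.\<close>
  define B where "B g = (\<Sum>i\<in>Z g. c ^ card (s i))" for g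
  have c: "c > 0" using fin by (auto simp: c_def card_gt_0_iff)
  have fO: "finite \<Omega>" using fin by (auto simp: \<Omega>_def intro!: finite_PiE)
  have fZ: "finite (Z g)" for g using fin by (auto simp: Z_def)
  have fs: "finite (s i)" if "i \<in> I" for i using S[OF that] fin finite_subset by blast
  have "?L = (\<Sum>f\<in>\<Omega>. \<Sum>i\<in>I. if i \<in> stuck s I j (colour_class X f a) then 1 else 0)"
    unfolding \<Omega>_def using fin by (intro sum.cong refl) (simp add: sum.If_cases stuck_def Int_def)
  also have "\<dots> = (\<Sum>i\<in>I. \<Sum>f\<in>\<Omega>. if i \<in> stuck s I j (colour_class X f a) then 1 else 0)"
    by (rule sum.swap)
  also have "\<dots> = (\<Sum>i\<in>I. card {f\<in>\<Omega>. i \<in> stuck s I j (colour_class X f a)})"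
    using fO by (intro sum.cong refl) (simp add: sum.If_cases Int_def)
  also have "real \<dots> \<le> (\<Sum>i\<in>I. c ^ card (s i) * real (card {g \<in> \<Omega>. i \<in> Z g}))"
    unfolding of_nat_sum
  proof (rule sum_mono)
    fix i assume i: "i \<in> I"
    show "real (card {f\<in>\<Omega>. i \<in> stuck s I j (colour_class X f a)})
      \<le> c ^ card (s i) * real (card {g \<in> \<Omega>. i \<in> Z g})"
      using card_stuck_colourings_le[of X C a I s i j, OF fin(1,3,4) S i] i
      unfolding c_def \<Omega>_def Z_def of_nat_power[symmetric] of_nat_mult[symmetric] of_nat_le_iff
      by simp
  qed
  also have "\<dots> = (\<Sum>i\<in>I. \<Sum>g\<in>\<Omega>. if i \<in> Z g then c ^ card (s i) else 0)"
    using fO by (intro sum.cong refl) (simp add: sum.If_cases Int_def)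
  also have "\<dots> = (\<Sum>g\<in>\<Omega>. \<Sum>i\<in>I. if i \<in> Z g then c ^ card (s i) else 0)"
    by (rule sum.swap)
  also have "\<dots> = (\<Sum>g\<in>\<Omega>. B g)"
    unfolding B_def using fin
    by (intro sum.cong refl sum.mono_neutral_cong_right) (auto simp: Z_def)
  finally have LB: "real ?L \<le> (\<Sum>g\<in>\<Omega>. B g)" .
  define J where "J i = {i'\<in>I. j \<le> card (s i \<inter> s i')}" for i
  have fJ: "finite (J i)" for i using fin by (auto simp: J_def)
  have Bsq: "(B g)\<^sup>2 \<le> (\<Sum>i\<in>I. \<Sum>i'\<in>J i. if s i \<union> s i' \<subseteq> colour_class X g a
      then c ^ (card (s i) + card (s i')) else 0)" for g
  proof -
    have "(B g)\<^sup>2 = (\<Sum>i\<in>Z g. \<Sum>i'\<in>Z g. c ^ (card (s i) + card (s i')))"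
      by (simp add: B_def power2_eq_square sum_product power_add)
    also have "\<dots> \<le> (\<Sum>i\<in>Z g. \<Sum>i'\<in>J i. if s i \<union> s i' \<subseteq> colour_class X g a
      then c ^ (card (s i) + card (s i')) else 0)"
    proof (rule sum_mono)
      fix i assume i: "i \<in> Z g"
      have "(\<Sum>i'\<in>Z g. c ^ (card (s i) + card (s i'))) = (\<Sum>i'\<in>Z g. if s i \<union> s i' \<subseteq> colour_class X g a
      then c ^ (card (s i) + card (s i')) else 0)"
        using i by (intro sum.cong refl) (auto simp: Z_def)
      also have "\<dots> \<le> (\<Sum>i'\<in>J i. if s i \<union> s i' \<subseteq> colour_class X g a
      then c ^ (card (s i) + card (s i')) else 0)"
        using i c fJ by (intro sum_mono2) (auto simp: Z_def J_def)
      finally show "(\<Sum>i'\<in>Z g. c ^ (card (s i) + card (s i'))) \<le> \<dots>" .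
    qed
    also have "\<dots> \<le> (\<Sum>i\<in>I. \<Sum>i'\<in>J i. if s i \<union> s i' \<subseteq> colour_class X g a
      then c ^ (card (s i) + card (s i')) else 0)"
      using c fin by (intro sum_mono2 sum_nonneg) (auto simp: Z_def)
    finally show ?thesis .
  qed
  have "(\<Sum>g\<in>\<Omega>. B g)\<^sup>2 \<le> real (card \<Omega>) * (\<Sum>g\<in>\<Omega>. (B g)\<^sup>2)"
    using sum_squared_le_sum_of_squares[of B \<Omega>] by (simp add: mult.commute)
  also have "(\<Sum>g\<in>\<Omega>. (B g)\<^sup>2) \<le> (\<Sum>g\<in>\<Omega>. \<Sum>i\<in>I. \<Sum>i'\<in>J i. if s i \<union> s i' \<subseteq> colour_class X g a
      then c ^ (card (s i) + card (s i')) else 0)"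
    by (rule sum_mono) (rule Bsq)
  also have "\<dots> = (\<Sum>i\<in>I. \<Sum>i'\<in>J i. \<Sum>g\<in>\<Omega>. if s i \<union> s i' \<subseteq> colour_class X g a
      then c ^ (card (s i) + card (s i')) else 0)"
    by (subst sum.swap, rule sum.cong[OF refl], rule sum.swap)
  also have "\<dots> = (\<Sum>i\<in>I. \<Sum>i'\<in>J i. c ^ card X * c ^ card (s i \<inter> s i'))"
  proof (intro sum.cong refl)
    fix i i' assume i: "i \<in> I" "i' \<in> J i"
    then have i': "i' \<in> I" by (auto simp: J_def)
    have sub: "s i \<union> s i' \<subseteq> X" using S i i' by auto
    have "(\<Sum>g\<in>\<Omega>. if s i \<union> s i' \<subseteq> colour_class X g a then c ^ (card (s i) + card (s i')) else 0)
       = c ^ (card (s i) + card (s i')) * real (card {g\<in>\<Omega>. s i \<union> s i' \<subseteq> colour_class X g a})"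
      using fO by (simp add: sum.If_cases Int_def)
    also have "\<dots> = c ^ (card (s i) + card (s i')) * c ^ (card X - card (s i \<union> s i'))"
      unfolding \<Omega>_def c_def using card_colourings_containing[OF fin(1,3,4) sub] by (simp only: of_nat_power)
    also have "\<dots> = c ^ (card (s i) + card (s i') + (card X - card (s i \<union> s i')))"
      by (simp add: power_add)
    also have "card (s i) + card (s i') + (card X - card (s i \<union> s i')) = card X + card (s i \<inter> s i')"
      using card_Un_Int[OF fs[OF i(1)] fs[OF i']] card_mono[OF fin(1) sub] by linarith
    finally show "(\<Sum>g\<in>\<Omega>. if s i \<union> s i' \<subseteq> colour_class X g a then c ^ (card (s i) + card (s i')) else 0)
       = c ^ card X * c ^ card (s i \<inter> s i')" by (simp add: power_add)
  qed
  also have "\<dots> = c ^ card X * (\<Sum>i\<in>I. \<Sum>i'\<in>J i. c ^ card (s i \<inter> s i'))"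
    by (simp add: sum_distrib_left)
  finally have "(\<Sum>g\<in>\<Omega>. B g)\<^sup>2 \<le> real (card \<Omega>) * (c ^ card X * (\<Sum>i\<in>I. \<Sum>i'\<in>J i. c ^ card (s i \<inter> s i')))"
    by (simp add: mult_left_mono)
  also have "real (card \<Omega>) = c ^ card X"
    using fin by (simp add: \<Omega>_def c_def card_funcsetE)
  finally have "(\<Sum>g\<in>\<Omega>. B g)\<^sup>2 \<le> (c ^ card X)\<^sup>2 * (\<Sum>i\<in>I. \<Sum>i'\<in>J i. c ^ card (s i \<inter> s i'))"
    by (simp add: power2_eq_square mult_ac)
  then have "(\<Sum>g\<in>\<Omega>. B g) \<le> sqrt ((c ^ card X)\<^sup>2 * (\<Sum>i\<in>I. \<Sum>i'\<in>J i. c ^ card (s i \<inter> s i')))"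
    by (rule real_le_rsqrt)
  also have "\<dots> = c ^ card X * sqrt (\<Sum>i\<in>I. \<Sum>i'\<in>J i. c ^ card (s i \<inter> s i'))"
    using c by (simp add: real_sqrt_mult)
  finally show ?thesis using LB unfolding c_def J_def by linarith
qed

lemma sum_power_card_subsets:
  fixes y :: "'a::comm_semiring_1"
  assumes "finite S"
  shows "(\<Sum>T\<in>Pow S. y ^ card T) = (1 + y) ^ card S"
  using prod_add[OF assms, of "\<lambda>_. y" "\<lambda>_. 1"] by (simp add: add.commute)

text \<open>
  Since \<open>l \<ge> 1\<close>, weighting each \<open>T\<close> by \<open>l ^ (card T - j)\<close> only increases the sum, and the weighted sum
  over all subsets is a power of \<open>1 + l y\<close>. The parameter \<open>l\<close> is left free because the two rounds
  need different choices.
\<close>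

lemma sum_power_card_large_subsets_le:
  fixes y l :: real
  assumes "finite S" "card S \<le> k" "y \<ge> 0" "l \<ge> 1"
  shows "(\<Sum>T\<in>{T\<in>Pow S. j \<le> card T}. y ^ card T) \<le> exp (l * y * real k) / l ^ j"
proof -
  have "(\<Sum>T\<in>{T\<in>Pow S. j \<le> card T}. y ^ card T) \<le> (\<Sum>T\<in>{T\<in>Pow S. j \<le> card T}. (l * y) ^ card T / l ^ j)"
  proof (rule sum_mono)
    fix T assume "T \<in> {T\<in>Pow S. j \<le> card T}"
    then have "l ^ j \<le> l ^ card T" using assms by (intro power_increasing) auto
    then have "y ^ card T * l ^ j \<le> y ^ card T * l ^ card T"
      using assms by (intro mult_left_mono) auto
    then show "y ^ card T \<le> (l * y) ^ card T / l ^ j"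
      using assms by (simp add: field_simps power_mult_distrib)
  qed
  also have "\<dots> \<le> (\<Sum>T\<in>Pow S. (l * y) ^ card T / l ^ j)"
    using assms by (intro sum_mono2) auto
  also have "\<dots> = (1 + l * y) ^ card S / l ^ j"
    using sum_power_card_subsets[OF assms(1), of "l * y"] by (simp flip: sum_divide_distrib)
  also have "\<dots> \<le> exp (l * y * real k) / l ^ j"
  proof (rule divide_right_mono)
    have "(1 + l * y) ^ card S \<le> exp (l * y) ^ card S"
      using assms by (intro power_mono exp_ge_add_one_self) auto
    also have "\<dots> = exp (l * y * real (card S))" by (simp add: exp_of_nat2_mult)
    also have "\<dots> \<le> exp (l * y * real k)" using assms by (auto intro!: mult_left_mono)
    finally show "(1 + l * y) ^ card S \<le> exp (l * y * real k)" .
  qed (use assms in auto)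
  finally show ?thesis .
qed

text \<open>
  The sets are indexed, since distinct members of a family may leave the same part to be completed and must
  still be counted separately. The slack \<open>\<kappa>\<close> absorbs what is lost by passing to large subfamilies.
\<close>

definition spread_family :: "real \<Rightarrow> real \<Rightarrow> ('i \<Rightarrow> 'a set) \<Rightarrow> 'i set \<Rightarrow> bool" where
  "spread_family \<kappa> R s I \<longleftrightarrow>
    (\<forall>T. finite T \<longrightarrow> real (card {i\<in>I. T \<subseteq> s i}) * R ^ card T \<le> \<kappa> * real (card I))"

text \<open>
  An index \<open>i'\<close> is charged to the set \<open>T = s i \<inter> s i'\<close>; by spreadness at most
  \<open>\<kappa> |I| / R ^ |T|\<close> indices are charged to each \<open>T\<close>.
\<close>

lemma sum_overlap_le:
  assumes fin: "finite I" and s: "\<And>i. i \<in> I \<Longrightarrow> finite (s i) \<and> card (s i) \<le> k"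
    and R: "R > 0" and c: "c \<ge> 0" and l: "l \<ge> 1" and k: "\<kappa> \<ge> 0"
    and spread: "spread_family \<kappa> R s I"
  shows "(\<Sum>i\<in>I. \<Sum>i'\<in>{i'\<in>I. j \<le> card (s i \<inter> s i')}. c ^ card (s i \<inter> s i'))
    \<le> (real (card I))\<^sup>2 * (\<kappa> * (exp (l * (c / R) * real k) / l ^ j))"
proof -
  let ?E = "exp (l * (c / R) * real k) / l ^ j"
  have "(\<Sum>i'\<in>{i'\<in>I. j \<le> card (s i \<inter> s i')}. c ^ card (s i \<inter> s i')) \<le> \<kappa> * real (card I) * ?E"
    if i: "i \<in> I" for i
  proof -
    define \<T> where "\<T> = {T\<in>Pow (s i). j \<le> card T}"
    have fT: "finite \<T>" using s[OF i] by (auto simp: \<T>_def)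
    have "(\<Sum>i'\<in>{i'\<in>I. j \<le> card (s i \<inter> s i')}. c ^ card (s i \<inter> s i'))
      \<le> (\<Sum>i'\<in>{i'\<in>I. j \<le> card (s i \<inter> s i')}. \<Sum>T\<in>\<T>. if T \<subseteq> s i' then c ^ card T else 0)"
    proof (rule sum_mono)
      fix i' assume i': "i' \<in> {i'\<in>I. j \<le> card (s i \<inter> s i')}"
      have "c ^ card (s i \<inter> s i') = (\<Sum>T\<in>{s i \<inter> s i'}. if T \<subseteq> s i' then c ^ card T else 0)"
        by simp
      also have "\<dots> \<le> (\<Sum>T\<in>\<T>. if T \<subseteq> s i' then c ^ card T else 0)"
        using fT c i' by (intro sum_mono2) (auto simp: \<T>_def)
      finally show "c ^ card (s i \<inter> s i') \<le> \<dots>" .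
    qed
    also have "\<dots> \<le> (\<Sum>i'\<in>I. \<Sum>T\<in>\<T>. if T \<subseteq> s i' then c ^ card T else 0)"
      using fin c by (intro sum_mono2) (auto intro!: sum_nonneg)
    also have "\<dots> = (\<Sum>T\<in>\<T>. \<Sum>i'\<in>I. if T \<subseteq> s i' then c ^ card T else 0)"
      by (rule sum.swap)
    also have "\<dots> = (\<Sum>T\<in>\<T>. c ^ card T * real (card {i'\<in>I. T \<subseteq> s i'}))"
      using fin by (intro sum.cong refl) (simp add: sum.If_cases Int_def)
    also have "\<dots> \<le> (\<Sum>T\<in>\<T>. \<kappa> * real (card I) * (c / R) ^ card T)"
    proof (rule sum_mono)
      fix T assume "T \<in> \<T>"
      then have "finite T" using s[OF i] finite_subset by (auto simp: \<T>_def)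
      then have "real (card {i\<in>I. T \<subseteq> s i}) * R ^ card T \<le> \<kappa> * real (card I)"
        using spread by (auto simp: spread_family_def)
      then have "real (card {i\<in>I. T \<subseteq> s i}) \<le> \<kappa> * real (card I) / R ^ card T"
        using R by (simp add: field_simps)
      then have "c ^ card T * real (card {i\<in>I. T \<subseteq> s i}) \<le> c ^ card T * (\<kappa> * real (card I) / R ^ card T)"
        using c by (intro mult_left_mono) auto
      also have "\<dots> = \<kappa> * real (card I) * (c / R) ^ card T" by (simp add: power_divide)
      finally show "c ^ card T * real (card {i\<in>I. T \<subseteq> s i}) \<le> \<dots>" .
    qed
    also have "\<dots> = \<kappa> * real (card I) * (\<Sum>T\<in>\<T>. (c / R) ^ card T)"
      by (simp add: sum_distrib_left)
    also have "\<dots> \<le> \<kappa> * real (card I) * ?E"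
      unfolding \<T>_def using s[OF i] c R l k
      by (intro mult_left_mono sum_power_card_large_subsets_le) auto
    finally show ?thesis .
  qed
  then have "(\<Sum>i\<in>I. \<Sum>i'\<in>{i'\<in>I. j \<le> card (s i \<inter> s i')}. c ^ card (s i \<inter> s i'))
    \<le> (\<Sum>i\<in>I. \<kappa> * real (card I) * ?E)" by (rule sum_mono)
  also have "\<dots> = (real (card I))\<^sup>2 * (\<kappa> * ?E)" by (simp add: power2_eq_square)
  finally show ?thesis .
qed

lemma spread_family_sum_card_stuck_le:
  assumes fin: "finite X" "finite I" "finite C" "a \<in> C" and S: "\<And>i. i \<in> I \<Longrightarrow> s i \<subseteq> X"
    and k: "\<And>i. i \<in> I \<Longrightarrow> card (s i) \<le> k"
    and R: "R > 0" and l: "l \<ge> 1" and kap: "\<kappa> \<ge> 0" and spread: "spread_family \<kappa> R s I"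
  shows "real (\<Sum>f\<in>X \<rightarrow>\<^sub>E C. card (stuck s I j (colour_class X f a)))
    \<le> real (card C) ^ card X * real (card I) *
        sqrt (\<kappa> * (exp (l * (real (card C) / R) * real k) / l ^ j))"
proof -
  have "real (\<Sum>f\<in>X \<rightarrow>\<^sub>E C. card (stuck s I j (colour_class X f a)))
    \<le> real (card C) ^ card X *
      sqrt (\<Sum>i\<in>I. \<Sum>i'\<in>{i'\<in>I. j \<le> card (s i \<inter> s i')}. real (card C) ^ card (s i \<inter> s i'))"
    using fin S by (rule sum_card_stuck_le)
  also have "\<dots> \<le> real (card C) ^ card X *
      sqrt ((real (card I))\<^sup>2 * (\<kappa> * (exp (l * (real (card C) / R) * real k) / l ^ j)))"
  proof (intro mult_left_mono real_sqrt_le_mono)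
    have s: "finite (s i) \<and> card (s i) \<le> k" if "i \<in> I" for i
      using S[OF that] k[OF that] fin(1) finite_subset by auto
    show "(\<Sum>i\<in>I. \<Sum>i'\<in>{i'\<in>I. j \<le> card (s i \<inter> s i')}. real (card C) ^ card (s i \<inter> s i'))
      \<le> (real (card I))\<^sup>2 * (\<kappa> * (exp (l * (real (card C) / R) * real k) / l ^ j))"
      by (rule sum_overlap_le[OF fin(2) s R _ l kap spread]) auto
  qed auto
  finally show ?thesis
    by (simp only: real_sqrt_mult[of "(real (card I))\<^sup>2"] real_sqrt_abs abs_of_nat mult.assoc)
qed

text \<open>
  A single round suffices if the sets have size at most \<open>k\<close>, much smaller than \<open>R\<close>. If no member lies
  in the colour class, then every index is stuck already for \<open>j = 1\<close>, so the bound on the number of stuck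
  indices becomes a bound on the number of colourings.
\<close>

lemma card_colourings_avoiding_le:
  assumes fin: "finite X" "finite I" "finite C" "b \<in> C" and S: "\<And>i. i \<in> I \<Longrightarrow> s i \<subseteq> X"
    and k: "\<And>i. i \<in> I \<Longrightarrow> card (s i) \<le> k" and I: "I \<noteq> {}" and k0: "k > 0"
    and R: "R \<ge> real (card C) * real k" and kap: "\<kappa> \<ge> 0" and spread: "spread_family \<kappa> R s I"
  shows "real (card {g \<in> X \<rightarrow>\<^sub>E C. \<forall>i\<in>I. \<not> s i \<subseteq> colour_class X g b})
    \<le> sqrt (\<kappa> * exp 1 * real (card C) * real k / R) * real (card C) ^ card X"
proof -
  let ?B = "{g \<in> X \<rightarrow>\<^sub>E C. \<forall>i\<in>I. \<not> s i \<subseteq> colour_class X g b}"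
  define c where "c = real (card C)"
  \<comment> \<open>This choice makes the exponent in the overlap bound equal to one.\<close>
  define l where "l = R / (c * real k)"
  have c: "c > 0" using fin by (auto simp: c_def card_gt_0_iff)
  then have R0: "R > 0" using R k0 by (simp add: c_def) (smt (verit) mult_pos_pos of_nat_0_less_iff)
  have l: "l \<ge> 1" using R c k0 by (simp add: l_def c_def)
  have I0: "real (card I) > 0" using I fin by (simp add: card_gt_0_iff)
  have fO: "finite (X \<rightarrow>\<^sub>E C)" using fin by (simp add: finite_PiE)
  have "real (card ?B) * real (card I) = real (\<Sum>g\<in>?B. card I)" by simp
  also have "\<dots> = real (\<Sum>g\<in>?B. card (stuck s I 1 (colour_class X g b)))"
  proof -
    have "stuck s I 1 (colour_class X g b) = I" if "g \<in> ?B" for g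
    proof -
      have "1 \<le> card (s i - colour_class X g b)" if i: "i \<in> I" for i
      proof -
        have "finite (s i)" using S[OF i] fin(1) finite_subset by blast
        moreover have "s i - colour_class X g b \<noteq> {}" using i \<open>g \<in> ?B\<close> by blast
        ultimately show ?thesis by (simp add: Suc_leI card_gt_0_iff)
      qed
      then show ?thesis by (auto simp: stuck_def)
    qed
    then show ?thesis by (intro arg_cong[where f=real] sum.cong) auto
  qed
  also have "\<dots> \<le> real (\<Sum>g\<in>X \<rightarrow>\<^sub>E C. card (stuck s I 1 (colour_class X g b)))"
    unfolding of_nat_le_iff by (rule sum_mono2[OF fO]) auto
  also have "\<dots> \<le> c ^ card X * real (card I) * sqrt (\<kappa> * (exp (l * (c / R) * real k) / l ^ 1))"
    unfolding c_def using fin S k R0 l kap spread by (rule spread_family_sum_card_stuck_le)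
  also have "\<kappa> * (exp (l * (c / R) * real k) / l ^ 1) = \<kappa> * exp 1 * c * real k / R"
    using R0 c k0 by (simp add: l_def)
  finally have "real (card ?B) * real (card I) \<le> (sqrt (\<kappa> * exp 1 * c * real k / R) * c ^ card X) * real (card I)"
    by (simp add: mult_ac)
  then show ?thesis using I0 unfolding c_def by (rule mult_right_le_imp_le)
qed

text \<open>
  Two rounds. The class of \<open>a\<close> is revealed first; for most colourings at least half of the indices
  are not stuck, and the parts that they still miss have size less than \<open>j\<close> and form a spread family. The
  points outside the class of \<open>a\<close> carry a uniformly random colouring with the remaining colours, and
  the class of \<open>b\<close> in it completes one of the missing parts by the single-round bound.
\<close>

lemma card_colourings_avoiding_two_colours_le:
  fixes s :: "'i \<Rightarrow> 'a set" and a b :: 'c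
  assumes fin: "finite X" "finite I" "finite C" "a \<in> C" "b \<in> C" "a \<noteq> b"
    and S: "\<And>i. i \<in> I \<Longrightarrow> s i \<subseteq> X"
    and k: "\<And>i. i \<in> I \<Longrightarrow> card (s i) \<le> k" and I: "I \<noteq> {}" and j: "j > 0"
    and R: "R \<ge> real (card C) * real j" and kap: "\<kappa> \<ge> 0" and spread: "spread_family \<kappa> R s I"
  shows "real (card {f \<in> X \<rightarrow>\<^sub>E C. \<forall>i\<in>I. \<not> s i \<subseteq> colour_class X f a \<union> colour_class X f b})
    \<le> (2 * sqrt (\<kappa> * (exp (2 * (real (card C) / R) * real k) / 2 ^ j))
        + sqrt (2 * \<kappa> * exp 1 * real (card C) * real j / R)) * real (card C) ^ card X"
proof -
  define C' where "C' = C - {a}"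
  define \<Omega> where "\<Omega> = X \<rightarrow>\<^sub>E C"
  define \<Omega>' where "\<Omega>' = X \<rightarrow>\<^sub>E C'"
  define c where "c = real (card C)"
  define c' where "c' = real (card C')"
  define Bad where "Bad = {f \<in> \<Omega>. \<forall>i\<in>I. \<not> s i \<subseteq> colour_class X f a \<union> colour_class X f b}"
  define J where "J f = I - stuck s I j (colour_class X f a)" for f
  define Bad1 where "Bad1 = {f \<in> \<Omega>. 2 * card (J f) < card I}"
  define \<eta> where "\<eta> = sqrt (\<kappa> * (exp (2 * (c / R) * real k) / 2 ^ j))"
  define \<eta>' where "\<eta>' = sqrt (2 * \<kappa> * exp 1 * c * real j / R)"
  have fC': "finite C'" "b \<in> C'" using fin by (auto simp: C'_def)
  have "card C' \<le> card C" using fin by (auto simp: C'_def intro: card_mono)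
  moreover have "card C > 0" "card C' > 0" using fin fC' card_gt_0_iff by blast+
  ultimately have c: "c > 0" "c' > 0" "c' \<le> c" by (auto simp: c_def c'_def)
  have R0: "R > 0" using R j c(1) unfolding c_def by (smt (verit) mult_pos_pos of_nat_0_less_iff)
  have fO: "finite \<Omega>" "finite \<Omega>'" using fin fC' by (simp_all add: \<Omega>_def \<Omega>'_def finite_PiE)
  have cO: "real (card \<Omega>) = c ^ card X" "real (card \<Omega>') = c' ^ card X"
    using fin by (simp_all add: \<Omega>_def \<Omega>'_def c_def c'_def card_funcsetE)
  have I0: "real (card I) > 0" using I fin by (simp add: card_gt_0_iff)

  have B1: "real (card Bad1) \<le> 2 * \<eta> * c ^ card X"
  proof -
    have st: "card (stuck s I j W) + card (I - stuck s I j W) = card I" for W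
    proof -
      have sub: "stuck s I j W \<subseteq> I" by (auto simp: stuck_def)
      show ?thesis
        using card_Diff_subset[OF finite_subset[OF sub fin(2)] sub] card_mono[OF fin(2) sub] by linarith
    qed
    have "real (card Bad1) * real (card I) \<le> 2 * real (\<Sum>f\<in>Bad1. card (stuck s I j (colour_class X f a)))"
    proof -
      have "(\<Sum>f\<in>Bad1. card I) \<le> (\<Sum>f\<in>Bad1. 2 * card (stuck s I j (colour_class X f a)))"
      proof (rule sum_mono)
        fix f assume "f \<in> Bad1"
        then show "card I \<le> 2 * card (stuck s I j (colour_class X f a))"
          using st[of "colour_class X f a"] by (simp add: Bad1_def J_def)
      qed
      then have "card Bad1 * card I \<le> 2 * (\<Sum>f\<in>Bad1. card (stuck s I j (colour_class X f a)))"
        by (simp add: sum_distrib_left)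
      then have "real (card Bad1 * card I) \<le> real (2 * (\<Sum>f\<in>Bad1. card (stuck s I j (colour_class X f a))))"
        by (rule of_nat_mono)
      then show ?thesis by simp
    qed
    also have "real (\<Sum>f\<in>Bad1. card (stuck s I j (colour_class X f a)))
        \<le> real (\<Sum>f\<in>\<Omega>. card (stuck s I j (colour_class X f a)))"
      unfolding of_nat_le_iff using fO by (intro sum_mono2) (auto simp: Bad1_def)
    also have "\<dots> \<le> c ^ card X * real (card I) * \<eta>"
      unfolding \<Omega>_def c_def \<eta>_def
      using fin(1-4) S k R0 _ kap spread by (rule spread_family_sum_card_stuck_le) auto
    finally have "real (card Bad1) * real (card I) \<le> (2 * \<eta> * c ^ card X) * real (card I)"
      by (simp add: mult_ac)
    then show ?thesis using I0 by (rule mult_right_le_imp_le)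
  qed

  define W where "W f i = (SOME i'. i' \<in> I \<and> s i' - colour_class X f a \<subseteq> s i \<and> card (s i' - colour_class X f a) < j)" for f i
  define \<chi> where "\<chi> f i = s (W f i) - colour_class X f a" for f i
  have W: "W f i \<in> I \<and> \<chi> f i \<subseteq> s i \<and> card (\<chi> f i) < j" if "i \<in> J f" for f i
  proof -
    have "\<exists>i'. i' \<in> I \<and> s i' - colour_class X f a \<subseteq> s i \<and> card (s i' - colour_class X f a) < j"
      using that by (auto simp: J_def stuck_def not_le)
    from someI_ex[OF this] show ?thesis unfolding W_def[symmetric] \<chi>_def[symmetric] .
  qed
  define Bad2 where "Bad2 f = {g \<in> \<Omega>'. \<forall>i\<in>J f. \<not> \<chi> f i \<subseteq> colour_class X g b}" for f
  have B2: "real (card (Bad2 f)) \<le> \<eta>' * c' ^ card X" if f: "f \<in> \<Omega> - Bad1" for f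
  proof -
    have Jf: "2 * card (J f) \<ge> card I" using f by (auto simp: Bad1_def)
    have fJ: "finite (J f)" using fin by (auto simp: J_def)
    have J0: "J f \<noteq> {}" using Jf I0 by auto
    have "spread_family (2 * \<kappa>) R (\<chi> f) (J f)" unfolding spread_family_def
    proof (intro allI impI)
      fix T :: "'a set" assume T: "finite T"
      have "real (card {i \<in> J f. T \<subseteq> \<chi> f i}) \<le> real (card {i \<in> I. T \<subseteq> s i})"
        using fin W by (intro of_nat_mono card_mono) (auto simp: J_def)
      then have "real (card {i \<in> J f. T \<subseteq> \<chi> f i}) * R ^ card T \<le> real (card {i \<in> I. T \<subseteq> s i}) * R ^ card T"
        using R0 by (intro mult_right_mono) auto
      also have "\<dots> \<le> \<kappa> * real (card I)" using spread T by (auto simp: spread_family_def)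
      also have "\<dots> \<le> \<kappa> * real (2 * card (J f))" using Jf kap by (intro mult_left_mono of_nat_mono) auto
      finally show "real (card {i \<in> J f. T \<subseteq> \<chi> f i}) * R ^ card T \<le> 2 * \<kappa> * real (card (J f))" by simp
    qed
    moreover have "\<chi> f i \<subseteq> X" if "i \<in> J f" for i using W[OF that] S by (auto simp: \<chi>_def)
    moreover have "card (\<chi> f i) \<le> j" if "i \<in> J f" for i using W[OF that] by simp
    moreover have "real (card C') * real j \<le> R"
      using R c(3) unfolding c_def c'_def by (smt (verit) mult_right_mono of_nat_0_le_iff)
    ultimately have "real (card (Bad2 f)) \<le> sqrt ((2 * \<kappa>) * exp 1 * real (card C') * real j / R) * real (card C') ^ card X"
      unfolding Bad2_def \<Omega>'_def using fin(1) fJ fC' J0 j kap by (intro card_colourings_avoiding_le) auto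
    also have "\<dots> \<le> \<eta>' * c' ^ card X"
      unfolding \<eta>'_def using c R0 kap unfolding c'_def
      by (intro mult_right_mono real_sqrt_le_mono divide_right_mono mult_left_mono) auto
    finally show ?thesis .
  qed

  \<comment> \<open>A colouring in C is split into two independent ones: the first decides which points get a, the
    second has colours in C - {a} and is used elsewhere. Exchanging the values of a bad colouring and of
    an arbitrary h wherever the former is not a gives such a pair, and the exchange can be undone
    because h never takes the value a.\<close>
  have "card (Bad \<times> \<Omega>') \<le> card (Bad1 \<times> \<Omega>' \<union> Sigma (\<Omega> - Bad1) Bad2)"
  proof (rule card_inj_on_le)
    let ?m = "\<lambda>(f::'a \<Rightarrow> 'c, h). (\<lambda>x\<in>X. if f x = a then a else h x, \<lambda>x\<in>X. if f x = a then h x else f x)"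
    show "inj_on ?m (Bad \<times> \<Omega>')"
    proof (rule inj_onI, clarify)
      fix f h f' h' assume *: "f \<in> Bad" "h \<in> \<Omega>'" "f' \<in> Bad" "h' \<in> \<Omega>'"
        and e1: "(\<lambda>x\<in>X. if f x = a then a else h x) = (\<lambda>x\<in>X. if f' x = a then a else h' x)"
        and e2: "(\<lambda>x\<in>X. if f x = a then h x else f x) = (\<lambda>x\<in>X. if f' x = a then h' x else f' x)"
      have "f x = f' x \<and> h x = h' x" for x
      proof (cases "x \<in> X")
        case True
        then have "h x \<noteq> a" "h' x \<noteq> a" using * by (auto simp: \<Omega>'_def C'_def PiE_iff)
        then show ?thesis using fun_cong[OF e1, of x] fun_cong[OF e2, of x] True by (auto split: if_splits)
      next
        case False
        then show ?thesis using * by (auto simp: Bad_def \<Omega>_def \<Omega>'_def PiE_iff extensional_def)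
      qed
      then show "f = f' \<and> h = h'" by auto
    qed
    show "?m ` (Bad \<times> \<Omega>') \<subseteq> Bad1 \<times> \<Omega>' \<union> Sigma (\<Omega> - Bad1) Bad2"
    proof (clarify, goal_cases)
      case (1 f g f0 h)
      then have f0: "f0 \<in> Bad" and h: "h \<in> \<Omega>'" by auto
      have h': "h x \<in> C" "h x \<noteq> a" if "x \<in> X" for x using h that by (auto simp: \<Omega>'_def C'_def PiE_iff)
      have f0': "f0 x \<in> C" if "x \<in> X" for x using f0 that by (auto simp: Bad_def \<Omega>_def PiE_iff)
      define f1 where "f1 = (\<lambda>x\<in>X. if f0 x = a then a else h x)"
      define g1 where "g1 = (\<lambda>x\<in>X. if f0 x = a then h x else f0 x)"
      have f1: "f1 \<in> \<Omega>" using h' fin by (auto simp: f1_def \<Omega>_def)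
      have g1: "g1 \<in> \<Omega>'" using h' f0' by (auto simp: g1_def \<Omega>'_def C'_def)
      have "\<not> \<chi> f1 i \<subseteq> colour_class X g1 b" if i: "i \<in> J f1" for i
      proof
        assume sub: "\<chi> f1 i \<subseteq> colour_class X g1 b"
        have "s (W f1 i) \<subseteq> colour_class X f0 a \<union> colour_class X f0 b"
        proof
          fix x assume x: "x \<in> s (W f1 i)"
          then have xX: "x \<in> X" using S W[OF i] by blast
          show "x \<in> colour_class X f0 a \<union> colour_class X f0 b"
          proof (cases "f0 x = a")
            case False
            then have "f1 x \<noteq> a" using xX h' by (simp add: f1_def)
            then have "x \<in> \<chi> f1 i" using x by (auto simp: \<chi>_def)
            then have "g1 x = b" using sub by auto
            then show ?thesis using False xX by (simp add: g1_def)
          qed (use xX in auto)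
        qed
        then show False using f0 W[OF i] by (auto simp: Bad_def)
      qed
      then have "g1 \<in> Bad2 f1" using g1 by (auto simp: Bad2_def)
      then show ?case using 1 f1 g1 unfolding f1_def[symmetric] g1_def[symmetric] by auto
    qed
    show "finite (Bad1 \<times> \<Omega>' \<union> Sigma (\<Omega> - Bad1) Bad2)"
      using fO by (auto simp: Bad1_def Bad2_def)
  qed
  also have "\<dots> \<le> card (Bad1 \<times> \<Omega>') + card (Sigma (\<Omega> - Bad1) Bad2)" by (rule card_Un_le)
  finally have "real (card Bad * card \<Omega>') \<le> real (card Bad1 * card \<Omega>' + card (Sigma (\<Omega> - Bad1) Bad2))"
    unfolding card_cartesian_product by (rule of_nat_mono)
  also have "\<dots> = real (card Bad1) * c' ^ card X + (\<Sum>f\<in>\<Omega> - Bad1. real (card (Bad2 f)))"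
    using fO cO by (subst card_SigmaI) (auto simp: Bad2_def)
  also have "\<dots> \<le> (2 * \<eta> * c ^ card X) * c' ^ card X + (\<Sum>f\<in>\<Omega> - Bad1. \<eta>' * c' ^ card X)"
    using c B1 B2 by (intro add_mono mult_right_mono sum_mono) auto
  also have "(\<Sum>f\<in>\<Omega> - Bad1. \<eta>' * c' ^ card X) \<le> (\<Sum>f\<in>\<Omega>. \<eta>' * c' ^ card X)"
    using fO c kap R0 by (intro sum_mono2) (auto simp: \<eta>'_def)
  also have "\<dots> = c ^ card X * (\<eta>' * c' ^ card X)" using cO by simp
  finally have "real (card Bad) * c' ^ card X \<le> ((2 * \<eta> + \<eta>') * c ^ card X) * c' ^ card X"
    using cO by (simp add: algebra_simps)
  then have "real (card Bad) \<le> (2 * \<eta> + \<eta>') * c ^ card X"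
    using c by (auto intro: mult_right_le_imp_le)
  then show ?thesis unfolding Bad_def \<Omega>_def \<eta>_def \<eta>'_def c_def .
qed

section \<open>Families spread over a set\<close>

definition spread_over :: "real \<Rightarrow> 'a set \<Rightarrow> 'a set set \<Rightarrow> bool" where
  "spread_over R S A \<longleftrightarrow> (\<forall>P\<in>A. S \<subseteq> P) \<and>
    (\<forall>T. finite T \<longrightarrow> T \<inter> S = {} \<longrightarrow> real (card {P\<in>A. T \<subseteq> P}) * R ^ card T \<le> real (card A))"

text \<open>
  The set \<open>S\<close> maximises \<open>card {P\<in>A. S \<subseteq> P} * R ^ card S\<close>. Comparing it with \<open>S \<union> T\<close>
  gives the spreadness, and comparing it with the empty set gives the size.
\<close>

lemma obtain_spread_restriction:
  assumes A: "finite A" "A \<noteq> {}" "\<And>P. P \<in> A \<Longrightarrow> finite P" and R: "R > 0"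
  obtains S where "spread_over R S {P\<in>A. S \<subseteq> P}" "{P\<in>A. S \<subseteq> P} \<noteq> {}"
    "real (card A) \<le> real (card {P\<in>A. S \<subseteq> P}) * R ^ card S"
proof -
  define \<Phi> where "\<Phi> S = real (card {P\<in>A. S \<subseteq> P}) * R ^ card S" for S
  let ?U = "Pow (\<Union>A)"
  have fU: "finite ?U" "?U \<noteq> {}" using A by auto
  then have "Max (\<Phi> ` ?U) \<in> \<Phi> ` ?U" by (intro Max_in) auto
  then obtain S where S: "S \<subseteq> \<Union>A" "\<Phi> S = Max (\<Phi> ` ?U)" by auto
  have max: "\<Phi> T \<le> \<Phi> S" if "T \<subseteq> \<Union>A" for T
    unfolding S(2) using that fU by (intro Max_ge) auto
  have fS: "finite S" using S(1) fU by (meson finite_Pow_iff finite_subset)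
  have 1: "real (card A) \<le> \<Phi> S" using max[of "{}"] by (simp add: \<Phi>_def)
  have "real (card A) > 0" using A by (simp add: card_gt_0_iff)
  then have "\<Phi> S > 0" using 1 by linarith
  then have 2: "{P\<in>A. S \<subseteq> P} \<noteq> {}" unfolding \<Phi>_def by (metis card.empty mult_zero_left of_nat_0 less_irrefl)
  have "real (card {P\<in>{P\<in>A. S \<subseteq> P}. T \<subseteq> P}) * R ^ card T \<le> real (card {P\<in>A. S \<subseteq> P})"
    if T: "finite T" "T \<inter> S = {}" for T
  proof (cases "S \<union> T \<subseteq> \<Union>A")
    case True
    have "{P\<in>{P\<in>A. S \<subseteq> P}. T \<subseteq> P} = {P\<in>A. S \<union> T \<subseteq> P}" by auto
    moreover have "card (S \<union> T) = card S + card T" using fS T by (subst card_Un_disjoint) auto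
    ultimately have "(real (card {P\<in>{P\<in>A. S \<subseteq> P}. T \<subseteq> P}) * R ^ card T) * R ^ card S
        \<le> real (card {P\<in>A. S \<subseteq> P}) * R ^ card S"
      using max[OF True] by (simp add: \<Phi>_def power_add mult_ac)
    then show ?thesis using R by (auto dest: mult_right_le_imp_le)
  next
    case False
    then have "{P\<in>{P\<in>A. S \<subseteq> P}. T \<subseteq> P} = {}" by blast
    then show ?thesis by (simp only: card.empty of_nat_0 mult_zero_left of_nat_0_le_iff)
  qed
  then have "spread_over R S {P\<in>A. S \<subseteq> P}" by (simp add: spread_over_def)
  then show ?thesis using 2 1[unfolded \<Phi>_def] by (rule that)
qed

text \<open>
  Planting a heavy set \<open>X\<close> keeps a spread family spread up to a factor: the members that
  contain \<open>X \<union> T\<close> are few by spreadness over \<open>S\<close>, and the members that contain \<open>X\<close> are many by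
  assumption. Discarding the members that meet the small set \<open>D\<close> removes at most half of what is left.
\<close>

lemma spread_family_planted:
  assumes A: "finite A" "A \<noteq> {}" and spread: "spread_over R S A" and X: "finite X" "X \<inter> S = {}"
    and heavy: "real (card A) \<le> real (card {P\<in>A. X \<subseteq> P}) * (R * b\<^sup>2) ^ card X"
    and R: "R > 0" and k: "b ^ (2 * card X) \<le> \<kappa>" "\<kappa> > 0"
    and D: "finite D" "D \<inter> (S \<union> X) = {}" "2 * real (card D) * \<kappa> \<le> R"
  shows "spread_family (2 * \<kappa>) R (\<lambda>P. P - (S \<union> X)) {P\<in>A. X \<subseteq> P \<and> P \<inter> D = {}}"
    and "{P\<in>A. X \<subseteq> P \<and> P \<inter> D = {}} \<noteq> {}"
proof -
  define A1 where "A1 = {P\<in>A. X \<subseteq> P}"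
  define I where "I = {P\<in>A. X \<subseteq> P \<and> P \<inter> D = {}}"
  have fA1: "finite A1" using A by (simp add: A1_def)
  have sub: "I \<subseteq> A1" by (auto simp: I_def A1_def)
  have S: "S \<subseteq> P" if "P \<in> A" for P using spread that by (auto simp: spread_over_def)
  have cA: "real (card A) > 0" using A by (simp add: card_gt_0_iff)
  have A1pos: "real (card A1) > 0"
  proof (rule ccontr)
    assume "\<not> ?thesis"
    then have "real (card A1) = 0" by simp
    then show False using heavy cA unfolding A1_def by simp
  qed
  have spread1: "real (card {P\<in>A1. T \<subseteq> P}) * R ^ card T \<le> \<kappa> * real (card A1)"
    if T: "finite T" "T \<inter> (S \<union> X) = {}" for T
  proof -
    have eq: "{P\<in>A1. T \<subseteq> P} = {P\<in>A. X \<union> T \<subseteq> P}" by (auto simp: A1_def)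
    have cXT: "card (X \<union> T) = card X + card T" using X T by (subst card_Un_disjoint) auto
    have "real (card {P\<in>A. X \<union> T \<subseteq> P}) * R ^ card (X \<union> T) \<le> real (card A)"
      using spread X T by (auto simp: spread_over_def Int_Un_distrib2)
    also have "\<dots> \<le> real (card A1) * (R * b\<^sup>2) ^ card X" using heavy by (simp add: A1_def)
    also have "(R * b\<^sup>2) ^ card X = b ^ (2 * card X) * R ^ card X"
      by (simp only: power_mult_distrib power_mult) (rule mult.commute)
    finally have "(real (card {P\<in>A1. T \<subseteq> P}) * R ^ card T) * R ^ card X
        \<le> (b ^ (2 * card X) * real (card A1)) * R ^ card X"
      by (simp add: eq cXT power_add mult_ac)
    then have "real (card {P\<in>A1. T \<subseteq> P}) * R ^ card T \<le> b ^ (2 * card X) * real (card A1)"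
      using R by (auto dest: mult_right_le_imp_le)
    also have "\<dots> \<le> \<kappa> * real (card A1)" using k by (intro mult_right_mono) auto
    finally show ?thesis .
  qed
  have "A1 - I = (\<Union>x\<in>D. {P\<in>A1. {x} \<subseteq> P})" by (auto simp: A1_def I_def)
  then have "card (A1 - I) \<le> (\<Sum>x\<in>D. card {P\<in>A1. {x} \<subseteq> P})"
    using card_UN_le[OF D(1)] by simp
  then have "real (card (A1 - I)) \<le> (\<Sum>x\<in>D. real (card {P\<in>A1. {x} \<subseteq> P}))"
    by (simp flip: of_nat_sum)
  also have "\<dots> \<le> (\<Sum>x\<in>D. \<kappa> * real (card A1) / R)"
  proof (rule sum_mono)
    fix x assume "x \<in> D"
    then have "real (card {P\<in>A1. {x} \<subseteq> P}) * R ^ card {x} \<le> \<kappa> * real (card A1)"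
      using D by (intro spread1) auto
    then show "real (card {P\<in>A1. {x} \<subseteq> P}) \<le> \<kappa> * real (card A1) / R" using R by (simp add: field_simps)
  qed
  also have "\<dots> = (2 * real (card D) * \<kappa>) * real (card A1) / (2 * R)" by simp
  also have "\<dots> \<le> R * real (card A1) / (2 * R)"
    using D R by (intro divide_right_mono mult_right_mono) auto
  also have "\<dots> = real (card A1) / 2" using R by simp
  finally have "real (card (A1 - I)) \<le> real (card A1) / 2" .
  moreover have "card (A1 - I) = card A1 - card I" "card I \<le> card A1"
    using sub fA1 by (auto intro: card_Diff_subset finite_subset card_mono)
  ultimately have half: "real (card A1) \<le> 2 * real (card I)" by simp
  then have "real (card I) > 0" using A1pos by linarith
  then show "{P\<in>A. X \<subseteq> P \<and> P \<inter> D = {}} \<noteq> {}" unfolding I_def[symmetric] by auto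
  show "spread_family (2 * \<kappa>) R (\<lambda>P. P - (S \<union> X)) {P\<in>A. X \<subseteq> P \<and> P \<inter> D = {}}"
    unfolding I_def[symmetric] spread_family_def
  proof (intro allI impI)
    fix T :: "'a set" assume T: "finite T"
    show "real (card {P\<in>I. T \<subseteq> P - (S \<union> X)}) * R ^ card T \<le> 2 * \<kappa> * real (card I)"
    proof (cases "T \<inter> (S \<union> X) = {}")
      case True
      have "real (card {P\<in>I. T \<subseteq> P - (S \<union> X)}) \<le> real (card {P\<in>A1. T \<subseteq> P})"
        using sub fA1 by (intro of_nat_mono card_mono) auto
      then have "real (card {P\<in>I. T \<subseteq> P - (S \<union> X)}) * R ^ card T \<le> real (card {P\<in>A1. T \<subseteq> P}) * R ^ card T"
        using R by (intro mult_right_mono) auto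
      also have "\<dots> \<le> \<kappa> * real (card A1)" using T True by (rule spread1)
      also have "\<dots> \<le> \<kappa> * (2 * real (card I))" using half k by (intro mult_left_mono) auto
      finally show ?thesis by simp
    next
      case False
      then have *: "{P\<in>I. T \<subseteq> P - (S \<union> X)} = {}" by blast
      show ?thesis unfolding * using k by simp
    qed
  qed
qed

section \<open>Graphs of permutations\<close>

definition graph :: "nat \<Rightarrow> (nat \<Rightarrow> nat) \<Rightarrow> (nat \<times> nat) set" where
  "graph n \<sigma> = (\<lambda>i. (i, \<sigma> i)) ` {1..n}"

definition perm_graphs :: "nat \<Rightarrow> (nat \<times> nat) set set" where
  "perm_graphs n = graph n ` Sym n"

lemma mem_graph_iff: "(i, v) \<in> graph n \<sigma> \<longleftrightarrow> i \<in> {1..n} \<and> v = \<sigma> i"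
  by (auto simp: graph_def)

lemma finite_Sym: "finite (Sym n)"
  by (simp add: Sym_def finite_permutations)

lemma finite_perm_graphs: "finite (perm_graphs n)"
  by (simp add: perm_graphs_def finite_Sym)

lemma perm_graphsD:
  assumes "P \<in> perm_graphs n"
  shows "P \<subseteq> {1..n} \<times> {1..n}" "finite P" "card P = n"
proof -
  obtain \<sigma> where s: "\<sigma> permutes {1..n}" "P = graph n \<sigma>"
    using assms by (auto simp: perm_graphs_def Sym_def)
  have "\<sigma> i \<in> {1..n}" if "i \<in> {1..n}" for i using that permutes_in_image[OF s(1)] by blast
  then show "P \<subseteq> {1..n} \<times> {1..n}" unfolding s(2) graph_def by blast
  show "finite P" by (simp add: s(2) graph_def)
  show "card P = n" unfolding s(2) graph_def by (subst card_image) (auto simp: inj_on_def)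
qed

lemma inj_on_graph: "inj_on (graph n) (Sym n)"
proof (rule inj_onI)
  fix \<sigma> \<tau> assume *: "\<sigma> \<in> Sym n" "\<tau> \<in> Sym n" "graph n \<sigma> = graph n \<tau>"
  have "\<sigma> i = \<tau> i" for i
  proof (cases "i \<in> {1..n}")
    case True
    then have "(i, \<sigma> i) \<in> graph n \<tau>" unfolding *(3)[symmetric] by (simp add: mem_graph_iff)
    then show ?thesis by (simp add: mem_graph_iff)
  next
    case False
    then show ?thesis using * by (simp add: Sym_def permutes_not_in)
  qed
  then show "\<sigma> = \<tau>" by auto
qed

lemma card_graph_Int: "card (graph n \<sigma> \<inter> graph n \<tau>) = card {i \<in> {1..n}. \<sigma> i = \<tau> i}"
proof -
  have "graph n \<sigma> \<inter> graph n \<tau> = (\<lambda>i. (i, \<sigma> i)) ` {i \<in> {1..n}. \<sigma> i = \<tau> i}"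
    by (auto simp: graph_def)
  then show ?thesis by (simp add: card_image inj_on_def)
qed

lemma card_perm_graphs_containing_le:
  "card {P \<in> perm_graphs n. S \<subseteq> P} \<le> fact (n - card S)"
proof (cases "{P \<in> perm_graphs n. S \<subseteq> P} = {}")
  case False
  define \<Sigma> where "\<Sigma> = {\<sigma> \<in> Sym n. S \<subseteq> graph n \<sigma>}"
  have "{P \<in> perm_graphs n. S \<subseteq> P} = graph n ` \<Sigma>" by (auto simp: perm_graphs_def \<Sigma>_def)
  then have eq: "card {P \<in> perm_graphs n. S \<subseteq> P} = card \<Sigma>"
    using inj_on_graph[of n] by (simp add: card_image inj_on_subset \<Sigma>_def)
  obtain \<sigma>0 where s0: "\<sigma>0 permutes {1..n}" "S \<subseteq> graph n \<sigma>0"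
    using False by (auto simp: perm_graphs_def Sym_def)
  define D where "D = fst ` S"
  have D: "D \<subseteq> {1..n}" using s0 by (auto simp: D_def graph_def)
  have "snd p = \<sigma>0 (fst p)" if "p \<in> S" for p using s0(2) that by (auto simp: graph_def)
  then have "inj_on fst S" by (metis inj_onI prod_eqI)
  then have cD: "card D = card S" by (simp add: D_def card_image)
  have "card \<Sigma> \<le> card {p. p permutes ({1..n} - D)}"
  proof (rule card_inj_on_le[where f = "\<lambda>\<sigma>. inv \<sigma>0 \<circ> \<sigma>"])
    show "inj_on (\<lambda>\<sigma>. inv \<sigma>0 \<circ> \<sigma>) \<Sigma>"
    proof (rule inj_onI)
      fix \<sigma> \<tau> assume "inv \<sigma>0 \<circ> \<sigma> = inv \<sigma>0 \<circ> \<tau>"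
      then have "\<sigma>0 \<circ> (inv \<sigma>0 \<circ> \<sigma>) = \<sigma>0 \<circ> (inv \<sigma>0 \<circ> \<tau>)" by simp
      then show "\<sigma> = \<tau>" using permutes_inv_o(1)[OF s0(1)] by (simp flip: comp_assoc)
    qed
    show "(\<lambda>\<sigma>. inv \<sigma>0 \<circ> \<sigma>) ` \<Sigma> \<subseteq> {p. p permutes ({1..n} - D)}"
    proof (rule image_subsetI)
      fix \<sigma> assume "\<sigma> \<in> \<Sigma>"
      then have s: "\<sigma> permutes {1..n}" "S \<subseteq> graph n \<sigma>" by (auto simp: \<Sigma>_def Sym_def)
      have "(inv \<sigma>0 \<circ> \<sigma>) permutes {1..n}"
        using s(1) permutes_inv[OF s0(1)] by (rule permutes_compose)
      moreover have "(inv \<sigma>0 \<circ> \<sigma>) x = x" if "x \<in> {1..n} - ({1..n} - D)" for x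
      proof -
        obtain y where "(x, y) \<in> S" using \<open>x \<in> {1..n} - ({1..n} - D)\<close> by (auto simp: D_def)
        then have "(x, y) \<in> graph n \<sigma>" "(x, y) \<in> graph n \<sigma>0" using s s0 by auto
        then have "\<sigma> x = \<sigma>0 x" by (simp add: mem_graph_iff)
        then show ?thesis using permutes_inverses(2)[OF s0(1)] by simp
      qed
      ultimately have "(inv \<sigma>0 \<circ> \<sigma>) permutes ({1..n} - D)" by (rule permutes_superset)
      then show "inv \<sigma>0 \<circ> \<sigma> \<in> {p. p permutes ({1..n} - D)}" by simp
    qed
    show "finite {p. p permutes ({1..n} - D)}" by (simp add: finite_permutations)
  qed
  also have "\<dots> = fact (n - card S)"
  proof (rule card_permutations)
    show "card ({1..n} - D) = n - card S" using D cD by (simp add: card_Diff_subset finite_subset)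
  qed simp
  finally show ?thesis using eq by simp
next
  case True
  then show ?thesis by (metis card.empty le0)
qed

section \<open>Entries used by two dense families of permutations\<close>

lemma power_mult_fact_le:
  fixes x :: real
  assumes "0 \<le> x" "x \<le> real n - real l" "l \<le> n"
  shows "x ^ l * fact (n - l) \<le> fact n"
proof -
  have "x ^ m * fact (n - m) \<le> fact n" if "m \<le> l" for m
    using that
  proof (induction m)
    case (Suc m)
    then have m: "m < n" using assms by simp
    have "x ^ Suc m * fact (n - Suc m) = x ^ m * (x * fact (n - Suc m))" by simp
    also have "\<dots> \<le> x ^ m * (real (n - m) * fact (n - Suc m))"
      using assms Suc.prems by (intro mult_left_mono mult_right_mono) auto
    also have "real (n - m) * fact (n - Suc m) = (fact (n - m) :: real)"
      using m by (simp add: fact_reduce)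
    also have "x ^ m * fact (n - m) \<le> fact n" using Suc by simp
    finally show ?case .
  qed simp
  then show ?thesis by simp
qed

text \<open>
  A given entry is used by a fraction \<open>1 / n\<close> of all permutations; it is light for \<open>A\<close> if
  the members of \<open>A\<close> use it less often than that by a factor of more than \<open>b\<close>.
\<close>

definition light :: "real \<Rightarrow> nat \<Rightarrow> (nat \<times> nat) set set \<Rightarrow> nat \<Rightarrow> nat set" where
  "light b n A i = {v \<in> {1..n}. real (card {P \<in> A. (i, v) \<in> P}) * (real n * b) < real (card A)}"

text \<open>
  If \<open>l\<close> rows had at least \<open>n / 3\<close> light entries each, then, as light entries are rare, at least half
  of \<open>A\<close> would avoid all light entries in these rows. But at most \<open>(2 n / 3) ^ l (n - l)!\<close> permutations
  do so, a fraction exponentially small in \<open>l\<close>, while \<open>A\<close> has density at least \<open>n\<close> to the power \<open>-C\<close>.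
\<close>

lemma card_rows_with_many_light_entries_less:
  assumes A: "A \<subseteq> perm_graphs n" "fact n \<le> real (card A) * real n ^ C"
    and n: "n > 0" and l: "2 * real l \<le> b" "6 * l \<le> n" "l > 0" "(5/4) ^ l > 2 * real n ^ C"
  shows "card {i \<in> {1..n}. n \<le> 3 * card (light b n A i)} < l"
proof (rule ccontr)
  assume "\<not> ?thesis"
  then obtain Q where Q: "Q \<subseteq> {i \<in> {1..n}. n \<le> 3 * card (light b n A i)}" "card Q = l" "finite Q"
    by (meson not_less obtain_subset_with_card_n)
  have fA: "finite A" using A finite_perm_graphs finite_subset by blast
  have fl: "finite (light b n A i)" "light b n A i \<subseteq> {1..n}" for i by (auto simp: light_def)
  have b: "b > 0" using l by simp
  define A' where "A' = {P \<in> A. \<forall>i\<in>Q. \<forall>v\<in>light b n A i. (i, v) \<notin> P}"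
  have "A - A' = (\<Union>i\<in>Q. \<Union>v\<in>light b n A i. {P \<in> A. (i, v) \<in> P})" by (auto simp: A'_def)
  then have "card (A - A') \<le> (\<Sum>i\<in>Q. card (\<Union>v\<in>light b n A i. {P \<in> A. (i, v) \<in> P}))"
    using Q(3) by (simp add: card_UN_le)
  also have "\<dots> \<le> (\<Sum>i\<in>Q. \<Sum>v\<in>light b n A i. card {P \<in> A. (i, v) \<in> P})"
    using fl by (intro sum_mono card_UN_le) auto
  finally have "real (card (A - A')) \<le> (\<Sum>i\<in>Q. \<Sum>v\<in>light b n A i. real (card {P \<in> A. (i, v) \<in> P}))"
    by (simp flip: of_nat_sum)
  also have "\<dots> \<le> (\<Sum>i\<in>Q. \<Sum>v\<in>light b n A i. real (card A) / (real n * b))"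
    using n b by (intro sum_mono) (auto simp: light_def field_simps)
  also have "\<dots> \<le> (\<Sum>i\<in>Q. real n * (real (card A) / (real n * b)))"
  proof (rule sum_mono)
    fix i
    have "card (light b n A i) \<le> n" using card_mono[OF _ fl(2), of i] by simp
    then show "(\<Sum>v\<in>light b n A i. real (card A) / (real n * b)) \<le> real n * (real (card A) / (real n * b))"
      using b by (simp only: sum_constant) (intro mult_right_mono, auto)
  qed
  also have "\<dots> = real l * real (card A) / b" using Q n by simp
  also have "\<dots> \<le> real (card A) / 2"
  proof -
    have "2 * real l * real (card A) \<le> b * real (card A)" using l by (intro mult_right_mono) auto
    then show ?thesis using b by (simp add: field_simps)
  qed
  finally have half: "real (card A) \<le> 2 * real (card A')"
  proof -
    assume *: "real (card (A - A')) \<le> real (card A) / 2"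
    have "A' \<subseteq> A" by (auto simp: A'_def)
    then have "card (A - A') = card A - card A'" "card A' \<le> card A"
      using fA by (auto intro: card_Diff_subset finite_subset card_mono)
    then show ?thesis using * by simp
  qed
  \<comment> \<open>The members of A' restrict to functions on the rows in Q that avoid the light entries; h ranges
    over all such functions.\<close>
  define H where "H = (\<Pi>\<^sub>E i\<in>Q. {1..n} - light b n A i)"
  define E where "E h = (\<lambda>i. (i, h i)) ` Q" for h :: "nat \<Rightarrow> nat"
  have fH: "finite H" using Q by (simp add: H_def finite_PiE)
  have "A' \<subseteq> (\<Union>h\<in>H. {P \<in> perm_graphs n. E h \<subseteq> P})"
  proof
    fix P assume P: "P \<in> A'"
    then obtain \<sigma> where s: "\<sigma> permutes {1..n}" "P = graph n \<sigma>"
      using A by (auto simp: A'_def perm_graphs_def Sym_def)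
    have "restrict \<sigma> Q \<in> H" "E (restrict \<sigma> Q) \<subseteq> P"
      using P Q(1) permutes_in_image[OF s(1)] unfolding A'_def s(2) H_def E_def graph_def
      by (auto simp: image_iff subset_iff)
    then show "P \<in> (\<Union>h\<in>H. {P \<in> perm_graphs n. E h \<subseteq> P})" using P A by (auto simp: A'_def)
  qed
  then have "card A' \<le> card (\<Union>h\<in>H. {P \<in> perm_graphs n. E h \<subseteq> P})"
    using fH finite_perm_graphs by (intro card_mono) auto
  also have "\<dots> \<le> (\<Sum>h\<in>H. card {P \<in> perm_graphs n. E h \<subseteq> P})" using fH by (rule card_UN_le)
  also have "\<dots> \<le> (\<Sum>h\<in>H. fact (n - l))"
  proof (rule sum_mono)
    fix h
    have "card (E h) = l" using Q by (simp add: E_def card_image inj_on_def)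
    then show "card {P \<in> perm_graphs n. E h \<subseteq> P} \<le> fact (n - l)"
      using card_perm_graphs_containing_le[of n "E h"] by simp
  qed
  also have "\<dots> = card H * fact (n - l)" by simp
  finally have "real (card A') \<le> real (card H) * fact (n - l)"
    by (metis of_nat_fact of_nat_le_iff of_nat_mult)
  also have "real (card H) \<le> (2 / 3 * real n) ^ l"
  proof -
    have "real (card H) = (\<Prod>i\<in>Q. real (card ({1..n} - light b n A i)))"
      using Q by (simp add: H_def card_PiE)
    also have "\<dots> \<le> (\<Prod>i\<in>Q. 2 / 3 * real n)"
    proof (intro prod_mono conjI)
      fix i assume i: "i \<in> Q"
      have "card ({1..n} - light b n A i) = n - card (light b n A i)"
        using fl[of i] by (simp add: card_Diff_subset)
      moreover have "n \<le> 3 * card (light b n A i)" using i Q by auto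
      moreover have "card (light b n A i) \<le> n" using card_mono[OF _ fl(2), of i] by simp
      ultimately show "real (card ({1..n} - light b n A i)) \<le> 2 / 3 * real n" by linarith
    qed auto
    finally show ?thesis using Q by simp
  qed
  finally have "real (card A') \<le> (2 / 3 * real n) ^ l * fact (n - l)" by simp
  then have "2 * real (card A') * real n ^ C \<le> 2 * ((2 / 3 * real n) ^ l * fact (n - l)) * real n ^ C"
    by (intro mult_right_mono) auto
  moreover have "real (card A) * real n ^ C \<le> 2 * real (card A') * real n ^ C"
    using half by (intro mult_right_mono) auto
  moreover have "(5 / 6 * real n) ^ l * fact (n - l) \<le> fact n"
    using l by (intro power_mult_fact_le) auto
  ultimately have "(5 / 6 * real n) ^ l * fact (n - l) \<le> 2 * ((2 / 3 * real n) ^ l * fact (n - l)) * real n ^ C"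
    using A(2) by linarith
  also have "\<dots> = (2 * real n ^ C * (2 / 3 * real n) ^ l) * fact (n - l)"
    by (simp only: mult_ac)
  finally have "(5 / 6 * real n) ^ l * fact (n - l) \<le> (2 * real n ^ C * (2 / 3 * real n) ^ l) * fact (n - l)" .
  then have "(5 / 6 * real n) ^ l \<le> 2 * real n ^ C * (2 / 3 * real n) ^ l"
    by (rule mult_right_le_imp_le) simp
  moreover have "(5 / 6 * real n) ^ l = (5 / 4) ^ l * (2 / 3 * real n) ^ l"
    by (simp flip: power_mult_distrib)
  ultimately have "(5 / 4) ^ l * (2 / 3 * real n) ^ l \<le> 2 * real n ^ C * (2 / 3 * real n) ^ l" by simp
  then have "(5 / 4 :: real) ^ l \<le> 2 * real n ^ C"
    by (rule mult_right_le_imp_le) (use n in auto)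
  then show False using l by simp
qed

text \<open>
  Outside the few exceptional rows, both families have fewer than \<open>n / 3\<close> light entries in a row, which
  leaves an entry that is light for neither.
\<close>

lemma obtain_common_heavy_entry:
  assumes A: "A \<subseteq> perm_graphs n" "fact n \<le> real (card A) * real n ^ C"
    and B: "B \<subseteq> perm_graphs n" "fact n \<le> real (card B) * real n ^ C"
    and n: "n > 0" and l: "2 * real l \<le> b" "6 * l \<le> n" "l > 0" "(5/4) ^ l > 2 * real n ^ C"
    and Y: "finite Y" "card Y + 2 * l \<le> n"
  obtains i v where "i \<notin> Y" "real (card A) \<le> real (card {P \<in> A. (i, v) \<in> P}) * (real n * b)"
    "real (card B) \<le> real (card {P \<in> B. (i, v) \<in> P}) * (real n * b)"
proof -
  define Q where "Q A = {i \<in> {1..n}. n \<le> 3 * card (light b n A i)}" for A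
  have "card (Q A \<union> Q B \<union> Y) \<le> card (Q A) + card (Q B) + card Y"
    by (meson add_le_mono1 card_Un_le le_trans)
  also have "\<dots> < n"
    using card_rows_with_many_light_entries_less[OF A n l] card_rows_with_many_light_entries_less[OF B n l] Y
    unfolding Q_def by linarith
  finally have "card (Q A \<union> Q B \<union> Y) < card {1..n}" by simp
  moreover have "finite (Q A \<union> Q B \<union> Y)" using Y by (auto simp: Q_def)
  ultimately have "\<not> {1..n} \<subseteq> Q A \<union> Q B \<union> Y" by (metis card_mono not_less)
  then obtain i where "i \<in> {1..n}" "i \<notin> Q A \<union> Q B \<union> Y" by blast
  then have i: "i \<in> {1..n}" "i \<notin> Y" "i \<notin> Q A" "i \<notin> Q B" by blast+
  have "card (light b n A i \<union> light b n B i) \<le> card (light b n A i) + card (light b n B i)" by (rule card_Un_le)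
  also have "\<dots> < n" using i by (auto simp: Q_def)
  finally have "card (light b n A i \<union> light b n B i) < card {1..n}" by simp
  moreover have "finite (light b n A i \<union> light b n B i)" by (auto simp: light_def)
  ultimately have "\<not> {1..n} \<subseteq> light b n A i \<union> light b n B i" by (metis card_mono not_less)
  then obtain v where "v \<in> {1..n}" "v \<notin> light b n A i" "v \<notin> light b n B i" by blast
  then show ?thesis using i that[of i v] by (auto simp: light_def not_less)
qed

text \<open>
  Heavy entries are planted one at a time, in new rows. Each step costs a factor of \<open>n b\<close>,
  at most \<open>n\<^sup>2\<close>, in the density, which is why the exponent \<open>C + 2 m\<close> occurs.
\<close>

lemma obtain_planted_entries:
  assumes A: "A \<subseteq> perm_graphs n" "fact n \<le> real (card A) * real n ^ C"
    and B: "B \<subseteq> perm_graphs n" "fact n \<le> real (card B) * real n ^ C"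
    and n: "n > 0" and b: "0 < b" "b \<le> real n"
    and l: "2 * real l \<le> b" "6 * l \<le> n" "l > 0" "(5/4) ^ l > 2 * real n ^ (C + 2 * m)"
    and Y: "finite Y" "card Y + m + 2 * l \<le> n"
  shows "d \<le> m \<Longrightarrow> \<exists>X. finite X \<and> card X = d \<and> X \<inter> Y = {} \<and>
    real (card A) \<le> real (card {P\<in>A. X \<subseteq> P}) * (real n * b) ^ d \<and>
    real (card B) \<le> real (card {P\<in>B. X \<subseteq> P}) * (real n * b) ^ d"
proof (induction d)
  case 0
  show ?case by (intro exI[of _ "{}"]) simp
next
  case (Suc d)
  then obtain X where X: "finite X" "card X = d" "X \<inter> Y = {}"
    and XA: "real (card A) \<le> real (card {P\<in>A. X \<subseteq> P}) * (real n * b) ^ d"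
    and XB: "real (card B) \<le> real (card {P\<in>B. X \<subseteq> P}) * (real n * b) ^ d" by auto
  have pw: "(real n * b) ^ d * real n ^ C \<le> real n ^ (C + 2 * m)"
  proof -
    have "(real n * b) ^ d \<le> (real n * real n) ^ d" using b n by (intro power_mono mult_left_mono) auto
    also have "\<dots> = real n ^ (2 * d)" by (simp add: power_mult power2_eq_square)
    also have "\<dots> \<le> real n ^ (2 * m)" using Suc n by (intro power_increasing) auto
    finally have "(real n * b) ^ d * real n ^ C \<le> real n ^ (2 * m) * real n ^ C"
      by (intro mult_right_mono) auto
    then show ?thesis by (simp add: power_add mult.commute)
  qed
  have dense: "fact n \<le> real (card {P\<in>A. X \<subseteq> P}) * real n ^ (C + 2 * m)"
    if "fact n \<le> real (card A) * real n ^ C"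
      "real (card A) \<le> real (card {P\<in>A. X \<subseteq> P}) * (real n * b) ^ d" for A :: "(nat \<times> nat) set set"
  proof -
    have "real (card A) * real n ^ C \<le> real (card {P\<in>A. X \<subseteq> P}) * (real n * b) ^ d * real n ^ C"
      using that by (intro mult_right_mono) auto
    also have "\<dots> \<le> real (card {P\<in>A. X \<subseteq> P}) * real n ^ (C + 2 * m)"
      using pw by (simp add: mult.assoc mult_left_mono)
    finally show ?thesis using that by linarith
  qed
  have "card (fst ` (X \<union> Y)) \<le> card (X \<union> Y)" using X Y by (intro card_image_le) auto
  also have "\<dots> \<le> card X + card Y" by (rule card_Un_le)
  finally have "card (fst ` (X \<union> Y)) + 2 * l \<le> n" using X Y Suc by linarith
  then have Y': "finite (fst ` (X \<union> Y))" "card (fst ` (X \<union> Y)) + 2 * l \<le> n" using X Y by auto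
  have sub: "{P\<in>A. X \<subseteq> P} \<subseteq> perm_graphs n" "{P\<in>B. X \<subseteq> P} \<subseteq> perm_graphs n" using A B by auto
  obtain i v where iv: "i \<notin> fst ` (X \<union> Y)"
      "real (card {P\<in>A. X \<subseteq> P}) \<le> real (card {P \<in> {P\<in>A. X \<subseteq> P}. (i, v) \<in> P}) * (real n * b)"
      "real (card {P\<in>B. X \<subseteq> P}) \<le> real (card {P \<in> {P\<in>B. X \<subseteq> P}. (i, v) \<in> P}) * (real n * b)"
    by (rule obtain_common_heavy_entry[OF sub(1) dense[OF A(2) XA] sub(2) dense[OF B(2) XB] n l Y'])
  have eq: "{P \<in> {P\<in>A. X \<subseteq> P}. (i, v) \<in> P} = {P\<in>A. insert (i, v) X \<subseteq> P}" for A by auto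
  have new: "(i, v) \<notin> X \<union> Y" using iv(1) by force
  have step: "real (card A) \<le> real (card {P\<in>A. insert (i, v) X \<subseteq> P}) * (real n * b) ^ Suc d"
    if "real (card A) \<le> real (card {P\<in>A. X \<subseteq> P}) * (real n * b) ^ d"
      "real (card {P\<in>A. X \<subseteq> P}) \<le> real (card {P \<in> {P\<in>A. X \<subseteq> P}. (i, v) \<in> P}) * (real n * b)" for A
  proof -
    have "real (card {P\<in>A. X \<subseteq> P}) * (real n * b) ^ d
      \<le> real (card {P \<in> {P\<in>A. X \<subseteq> P}. (i, v) \<in> P}) * (real n * b) * (real n * b) ^ d"
      using that(2) b by (intro mult_right_mono) auto
    then show ?thesis using that(1) unfolding eq by (simp add: mult_ac)
  qed
  show ?case
    using step[OF XA iv(2)] step[OF XB iv(3)] X new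
    by (intro exI[of _ "insert (i, v) X"]) auto
qed

section \<open>Members of two spread families with a prescribed intersection size\<close>

text \<open>
  In a random colouring with four colours, the first family misses the colours \<open>0, 1\<close> with probability less
  than a half, and so does the second family for the colours \<open>2, 3\<close>. Hence some colouring serves both.
\<close>

lemma obtain_disjointly_coloured_members:
  fixes s :: "'i \<Rightarrow> 'a set" and s' :: "'j \<Rightarrow> 'a set"
  assumes fin: "finite X" "finite I" "finite I'" "I \<noteq> {}" "I' \<noteq> {}"
    and S: "\<And>i. i \<in> I \<Longrightarrow> s i \<subseteq> X" "\<And>i. i \<in> I \<Longrightarrow> card (s i) \<le> k"
    and S': "\<And>i. i \<in> I' \<Longrightarrow> s' i \<subseteq> X" "\<And>i. i \<in> I' \<Longrightarrow> card (s' i) \<le> k"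
    and j: "j > 0" "4 * real j \<le> R" and kap: "\<kappa> \<ge> 0"
    and small: "2 * sqrt (\<kappa> * (exp (2 * (4 / R) * real k) / 2 ^ j)) + sqrt (2 * \<kappa> * exp 1 * 4 * real j / R) < 1 / 2"
    and spread: "spread_family \<kappa> R s I" "spread_family \<kappa> R s' I'"
  obtains i i' where "i \<in> I" "i' \<in> I'" "s i \<inter> s' i' = {}"
proof -
  define C where "C = {0, 1, 2, 3 :: nat}"
  have C: "finite C" "0 \<in> C" "1 \<in> C" "2 \<in> C" "3 \<in> C" "card C = 4" by (auto simp: C_def)
  define \<Omega> where "\<Omega> = X \<rightarrow>\<^sub>E C"
  define B1 where "B1 = {f \<in> \<Omega>. \<forall>i\<in>I. \<not> s i \<subseteq> colour_class X f 0 \<union> colour_class X f 1}"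
  define B2 where "B2 = {f \<in> \<Omega>. \<forall>i\<in>I'. \<not> s' i \<subseteq> colour_class X f 2 \<union> colour_class X f 3}"
  have fO: "finite \<Omega>" using fin C by (simp add: \<Omega>_def finite_PiE)
  have cO: "real (card \<Omega>) = 4 ^ card X" using fin C by (simp add: \<Omega>_def card_funcsetE)
  have jR: "real (card C) * real j \<le> R" using j C by simp
  have sm: "(2 * sqrt (\<kappa> * (exp (2 * (real (card C) / R) * real k) / 2 ^ j))
        + sqrt (2 * \<kappa> * exp 1 * real (card C) * real j / R)) * real (card C) ^ card X < 4 ^ card X / 2"
    using small C by simp
  have "real (card B1) < 4 ^ card X / 2"
    unfolding B1_def \<Omega>_def
    using card_colourings_avoiding_two_colours_le[OF fin(1,2) C(1,2,3) _ S fin(4) j(1) jR kap spread(1)] sm by simp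
  moreover have "real (card B2) < 4 ^ card X / 2"
    unfolding B2_def \<Omega>_def
    using card_colourings_avoiding_two_colours_le[OF fin(1,3) C(1,4,5) _ S' fin(5) j(1) jR kap spread(2)] sm by simp
  ultimately have "real (card B1 + card B2) < real (card \<Omega>)" unfolding cO by simp
  then have "card (B1 \<union> B2) < card \<Omega>" using card_Un_le[of B1 B2] by linarith
  moreover have "finite (B1 \<union> B2)" using fO by (simp add: B1_def B2_def)
  ultimately have "\<not> \<Omega> \<subseteq> B1 \<union> B2" by (metis card_mono not_less)
  then obtain f where f: "f \<in> \<Omega>" "f \<notin> B1" "f \<notin> B2" by blast
  then obtain i i' where "i \<in> I" "s i \<subseteq> colour_class X f 0 \<union> colour_class X f 1"
    "i' \<in> I'" "s' i' \<subseteq> colour_class X f 2 \<union> colour_class X f 3" by (auto simp: B1_def B2_def)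
  then show ?thesis using that[of i i'] by fastforce
qed

text \<open>
  After planting \<open>X\<close>, members over \<open>S \<union> X\<close> that avoid \<open>S' - S\<close> and members over \<open>S' \<union> X\<close> that
  avoid \<open>S - S'\<close> meet exactly in \<open>(S \<inter> S') \<union> X\<close> as soon as their remaining parts are disjoint.
\<close>

lemma obtain_exact_intersection:
  assumes A: "A \<subseteq> perm_graphs n" "fact n \<le> real (card A) * real n ^ C" "spread_over R S A"
    and B: "B \<subseteq> perm_graphs n" "fact n \<le> real (card B) * real n ^ C" "spread_over R S' B"
    and S: "finite S" "finite S'" "card S \<le> q" "card S' \<le> q" "card (S \<inter> S') \<le> m"
    and n: "n > 0" and b: "1 \<le> b" "b \<le> real n" and R: "R * b = real n"
    and l: "2 * real l \<le> b" "6 * l \<le> n" "l > 0" "(5/4) ^ l > 2 * real n ^ (C + 2 * m)"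
    and q: "2 * q + m + 2 * l \<le> n" "2 * real q * b ^ (2 * m) \<le> R"
    and j: "j > 0" "4 * real j \<le> R"
    and small: "2 * sqrt (2 * b ^ (2 * m) * (exp (2 * (4 / R) * real n) / 2 ^ j))
        + sqrt (2 * (2 * b ^ (2 * m)) * exp 1 * 4 * real j / R) < 1 / 2"
  obtains P P' where "P \<in> A" "P' \<in> B" "card (P \<inter> P') = m"
proof -
  define d where "d = m - card (S \<inter> S')"
  define \<kappa> where "\<kappa> = b ^ (2 * m)"
  have R0: "R > 0" using R n b by (metis mult_nonpos_nonneg not_less of_nat_0_less_iff order_trans zero_le_one)
  have Rb: "real n * b = R * b\<^sup>2" unfolding R[symmetric] by (simp add: power2_eq_square)
  have "card (S \<union> S') + m + 2 * l \<le> n" using S q(1) card_Un_le[of S S'] by linarith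
  then have Y: "finite (S \<union> S')" "card (S \<union> S') + m + 2 * l \<le> n" using S by auto
  have d: "d \<le> m" "0 < b" using b by (auto simp: d_def)
  obtain X where X: "finite X" "card X = d" "X \<inter> (S \<union> S') = {}"
    and XA: "real (card A) \<le> real (card {P\<in>A. X \<subseteq> P}) * (R * b\<^sup>2) ^ card X"
    and XB: "real (card B) \<le> real (card {P\<in>B. X \<subseteq> P}) * (R * b\<^sup>2) ^ card X"
    using obtain_planted_entries[OF A(1,2) B(1,2) n d(2) b(2) l Y d(1)] unfolding Rb by blast
  have fin: "finite A" "finite B" using A B finite_perm_graphs finite_subset by blast+
  have ne: "A \<noteq> {}" "B \<noteq> {}"
    using A(2) B(2) by (metis card.empty fact_gt_zero mult_zero_left not_less of_nat_0)+
  have k: "b ^ (2 * card X) \<le> \<kappa>" "\<kappa> > 0"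
    unfolding \<kappa>_def X(2) d_def using b by (auto intro!: power_increasing)
  define D where "D = S' - S"
  define D' where "D' = S - S'"
  have D: "finite D" "D \<inter> (S \<union> X) = {}" "2 * real (card D) * \<kappa> \<le> R"
    and D': "finite D'" "D' \<inter> (S' \<union> X) = {}" "2 * real (card D') * \<kappa> \<le> R"
  proof -
    show "finite D" "D \<inter> (S \<union> X) = {}" "finite D'" "D' \<inter> (S' \<union> X) = {}"
      using S X by (auto simp: D_def D'_def)
    have "card D \<le> q" "card D' \<le> q"
      using S by (auto simp: D_def D'_def intro: order.trans[OF card_mono])
    then have "2 * real (card D) * \<kappa> \<le> 2 * real q * \<kappa>" "2 * real (card D') * \<kappa> \<le> 2 * real q * \<kappa>"
      using k by (auto intro!: mult_right_mono)
    then show "2 * real (card D) * \<kappa> \<le> R" "2 * real (card D') * \<kappa> \<le> R"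
      using q(2) unfolding \<kappa>_def by linarith+
  qed
  define I where "I = {P\<in>A. X \<subseteq> P \<and> P \<inter> D = {}}"
  define I' where "I' = {P\<in>B. X \<subseteq> P \<and> P \<inter> D' = {}}"
  have XS: "X \<inter> S = {}" "X \<inter> S' = {}" using X by auto
  note I = spread_family_planted[OF fin(1) ne(1) A(3) X(1) XS(1) XA R0 k D, folded I_def]
  note I' = spread_family_planted[OF fin(2) ne(2) B(3) X(1) XS(2) XB R0 k D', folded I'_def]
  have PI: "P - Z \<subseteq> {1..n} \<times> {1..n} \<and> card (P - Z) \<le> n" if "P \<in> I \<union> I'" for P Z
  proof -
    have "P \<in> perm_graphs n" using that A B by (auto simp: I_def I'_def)
    from perm_graphsD[OF this] show ?thesis using card_mono[of P "P - Z"] by auto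
  qed
  obtain P P' where P: "P \<in> I" "P' \<in> I'" "(P - (S \<union> X)) \<inter> (P' - (S' \<union> X)) = {}"
  proof (rule obtain_disjointly_coloured_members[where s = "\<lambda>P. P - (S \<union> X)" and s' = "\<lambda>P. P - (S' \<union> X)"
        and X = "{1..n} \<times> {1..n}" and I = I and I' = I' and k = n and j = j and R = R and \<kappa> = "2 * \<kappa>"])
    show "finite I" "finite I'" using fin by (auto simp: I_def I'_def)
    show "2 * sqrt (2 * \<kappa> * (exp (2 * (4 / R) * real n) / 2 ^ j)) + sqrt (2 * (2 * \<kappa>) * exp 1 * 4 * real j / R) < 1 / 2"
      using small by (simp add: \<kappa>_def)
  qed (use I I' PI j k in auto)
  have SP: "S \<subseteq> P" "S' \<subseteq> P'" using P A(3) B(3) by (auto simp: spread_over_def I_def I'_def)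
  have "P \<inter> P' = (S \<inter> S') \<union> X"
    using P SP unfolding I_def I'_def D_def D'_def by blast
  moreover have "card ((S \<inter> S') \<union> X) = card (S \<inter> S') + card X"
    using S X by (intro card_Un_disjoint) auto
  ultimately have "card (P \<inter> P') = m" using X S by (simp add: d_def)
  then show ?thesis using that[of P P'] P by (auto simp: I_def I'_def)
qed

section \<open>Generators\<close>

lemma power_div_3_le_fact: "(real m / 3) ^ m \<le> fact m"
proof (induction m)
  case (Suc m)
  show ?case
  proof (cases "m = 0")
    case False
    have "(1 + 1 / real m) ^ m \<le> exp 1"
      using exp_ge_one_plus_x_over_n_power_n[of m 1] False by simp
    then have "(1 + 1 / real m) ^ m \<le> 3" using exp_le by linarith
    then have "(real m / 3) ^ m * (1 + 1 / real m) ^ m \<le> (real m / 3) ^ m * 3"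
      by (intro mult_left_mono) auto
    moreover have "real m / 3 * (1 + 1 / real m) = real (Suc m) / 3"
      using False by (simp add: field_simps)
    then have "(real m / 3) ^ m * (1 + 1 / real m) ^ m = (real (Suc m) / 3) ^ m"
      by (simp only: power_mult_distrib[symmetric])
    ultimately have "(real (Suc m) / 3) ^ m \<le> (real m / 3) ^ m * 3" by linarith
    then have "real (Suc m) / 3 * (real (Suc m) / 3) ^ m \<le> real (Suc m) / 3 * ((real m / 3) ^ m * 3)"
      by (intro mult_left_mono) auto
    also have "\<dots> = real (Suc m) * (real m / 3) ^ m" by simp
    also have "\<dots> \<le> real (Suc m) * fact m" using Suc by (intro mult_left_mono) auto
    finally show ?thesis by simp
  qed simp
qed simp

lemma power_div_3_mult_fact_le:
  assumes "m \<le> N"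
  shows "(real N / 3) ^ m * fact (N - m) \<le> fact N"
proof (cases "m = 0")
  case False
  have "(real N / 3) ^ m = (real N / real m) ^ m * (real m / 3) ^ m"
    using False by (simp flip: power_mult_distrib)
  also have "\<dots> \<le> real (N choose m) * fact m"
    using binomial_ge_n_over_k_pow_k[OF assms, where ?'a = real] power_div_3_le_fact
    by (intro mult_mono) auto
  finally have "(real N / 3) ^ m * fact (N - m) \<le> real (N choose m) * fact m * fact (N - m)"
    by (intro mult_right_mono) auto
  also have "\<dots> = real (fact m * fact (N - m) * (N choose m))" by simp
  also have "\<dots> = fact N" by (subst binomial_fact_lemma[OF assms]) simp
  finally show ?thesis .
qed simp

text \<open>
  Beyond the first \<open>r\<close> points, fixing points of a permutation divides the number of choices by at least
  \<open>n / 6\<close> per point on average, whereas \<open>R ^ s\<close> compensates for only \<open>n / b\<close> per point. The difference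
  accumulates, so the compensation can cover a deficit of \<open>n ^ r\<close> only while \<open>s\<close> is bounded. The
  threshold \<open>36\<close> makes the loss of \<open>6\<close> per point at most the square root of the gain \<open>b\<close>.
\<close>

lemma restriction_size_le:
  assumes b: "36 \<le> b" and n: "real n = b ^ M" and R: "R * b = real n" and r: "2 * r \<le> n"
    and s: "s \<le> n" and le: "fact (n - r) \<le> fact (n - s) * R ^ s"
  shows "s \<le> r + 2 * r * M"
proof (rule ccontr)
  assume "\<not> ?thesis"
  then have sr: "r + 2 * r * M < s" by simp
  define m where "m = s - r"
  have mN: "m \<le> n - r" "n - r - m = n - s" using sr s by (auto simp: m_def)
  have n6: "real n / 6 \<le> real (n - r) / 3" using r by simp
  have "(real n / 6) ^ m * fact (n - s) \<le> (real (n - r) / 3) ^ m * fact (n - s)"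
    using n6 by (intro mult_right_mono power_mono) auto
  also have "\<dots> \<le> fact (n - r)" using power_div_3_mult_fact_le[OF mN(1)] mN(2) by simp
  also have "\<dots> \<le> R ^ s * fact (n - s)" using le by (simp add: mult.commute)
  finally have "(real n / 6) ^ m \<le> R ^ s" by (rule mult_right_le_imp_le) simp
  then have "(real n / 6) ^ m * (6 ^ m * b ^ s) \<le> R ^ s * (6 ^ m * b ^ s)"
    using b by (intro mult_right_mono) auto
  then have "(real n / 6 * 6) ^ m * b ^ s \<le> 6 ^ m * (R * b) ^ s"
    by (simp only: power_mult_distrib mult_ac)
  also have "(R * b) ^ s = real n ^ r * real n ^ m"
    using sr by (simp add: R m_def flip: power_add)
  finally have "b ^ s * real n ^ m \<le> (6 ^ m * real n ^ r) * real n ^ m" by (simp add: mult_ac)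
  moreover have "real n > 0" using n b by simp
  ultimately have "b ^ s \<le> 6 ^ m * real n ^ r" by (auto dest: mult_right_le_imp_le)
  also have "real n ^ r = b ^ (M * r)" by (simp add: n power_mult)
  finally have "(b ^ s) ^ 2 \<le> (6 ^ m * b ^ (M * r)) ^ 2" using b by (intro power_mono) auto
  also have "\<dots> = 36 ^ m * b ^ (2 * M * r)"
  proof -
    have "((6::real) ^ m) ^ 2 = 36 ^ m" by (simp add: power2_eq_square flip: power_mult_distrib)
    moreover have "(b ^ (M * r)) ^ 2 = b ^ (2 * M * r)" by (metis power_mult mult.commute mult.assoc)
    ultimately show ?thesis by (simp only: power_mult_distrib)
  qed
  also have "\<dots> \<le> b ^ m * b ^ (2 * M * r)" using b by (intro mult_right_mono power_mono) auto
  finally have "b ^ (2 * s) \<le> b ^ (m + 2 * M * r)" by (simp add: power_add power_mult mult.commute)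
  then have "2 * s \<le> m + 2 * M * r" using b by (subst (asm) power_increasing_iff) auto
  then show False using sr by (simp add: m_def mult_ac)
qed

text \<open>
  Fix a generator \<open>S1\<close>, and for every \<open>t\<close>-element subset \<open>T\<close> of it a generator \<open>g T\<close> that does
  not contain \<open>T\<close>. A generator that meets \<open>S1\<close> in more than \<open>t\<close> points contains a set of size \<open>t + 1\<close>
  inside \<open>S1\<close>. One that meets \<open>S1\<close> exactly in \<open>T\<close> has to share a point outside \<open>T\<close> with \<open>g T\<close>. In both cases it
  contains some \<open>insert x T\<close> with \<open>x\<close> in \<open>S1 \<union> g T\<close>, and the number of these sets is bounded.
\<close>

lemma card_covered_by_intersecting_generators_le:
  assumes gen: "\<And>S. S \<in> \<S> \<Longrightarrow> finite S \<and> card S \<le> q"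
    and inter: "\<And>S S'. S \<in> \<S> \<Longrightarrow> S' \<in> \<S> \<Longrightarrow> t \<le> card (S \<inter> S')"
    and no_kernel: "\<And>T. finite T \<Longrightarrow> card T = t \<Longrightarrow> \<exists>S\<in>\<S>. \<not> T \<subseteq> S"
    and A: "A \<subseteq> perm_graphs n" "\<And>P. P \<in> A \<Longrightarrow> \<exists>S\<in>\<S>. S \<subseteq> P"
  shows "card A \<le> 2 ^ q * (2 * q) * fact (n - t - 1)"
proof (cases "A = {}")
  case False
  then obtain S1 where S1: "S1 \<in> \<S>" using A by blast
  define \<T> where "\<T> = {T \<in> Pow S1. card T = t}"
  have "\<exists>g. \<forall>T\<in>\<T>. g T \<in> \<S> \<and> \<not> T \<subseteq> g T"
  proof (rule bchoice, rule ballI)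
    fix T assume "T \<in> \<T>"
    then have "finite T" "card T = t" using gen[OF S1] finite_subset by (auto simp: \<T>_def)
    then show "\<exists>S. S \<in> \<S> \<and> \<not> T \<subseteq> S" using no_kernel by blast
  qed
  then obtain g where g: "\<And>T. T \<in> \<T> \<Longrightarrow> g T \<in> \<S>" "\<And>T. T \<in> \<T> \<Longrightarrow> \<not> T \<subseteq> g T" by blast
  have fT: "finite \<T>" using gen[OF S1] by (simp add: \<T>_def)
  have fE: "finite ((S1 \<union> g T) - T)" if "T \<in> \<T>" for T using gen[OF S1] gen[OF g(1)[OF that]] by auto
  have "A \<subseteq> (\<Union>T\<in>\<T>. \<Union>x\<in>(S1 \<union> g T) - T. {P \<in> perm_graphs n. insert x T \<subseteq> P})"
  proof
    fix P assume P: "P \<in> A"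
    then obtain S where S: "S \<in> \<S>" "S \<subseteq> P" using A by blast
    have "\<exists>T\<in>\<T>. \<exists>x\<in>(S1 \<union> g T) - T. insert x T \<subseteq> S"
    proof (cases "card (S \<inter> S1) = t")
      case True
      define T where "T = S \<inter> S1"
      have T: "T \<in> \<T>" using True by (auto simp: \<T>_def T_def)
      have fT: "finite T" using gen[OF S1] by (simp add: T_def)
      have "\<not> S \<inter> g T \<subseteq> T"
      proof
        assume sub: "S \<inter> g T \<subseteq> T"
        have "card T \<le> card (S \<inter> g T)" using inter[OF S(1) g(1)[OF T]] True by (simp add: T_def)
        then have "S \<inter> g T = T" using sub fT by (meson card_seteq)
        then show False using g(2)[OF T] by blast
      qed
      then show ?thesis using T by (auto simp: T_def)
    next
      case False
      then have "t < card (S \<inter> S1)" using inter[OF S(1) S1] by simp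
      then obtain T where T: "T \<subseteq> S \<inter> S1" "card T = t" "finite T"
        by (meson less_imp_le obtain_subset_with_card_n)
      have "T \<noteq> S \<inter> S1" using False T by auto
      then obtain x where "x \<in> S \<inter> S1" "x \<notin> T" using T by blast
      moreover have "T \<in> \<T>" using T by (auto simp: \<T>_def)
      ultimately show ?thesis using T by (intro bexI[of _ T] bexI[of _ x]) auto
    qed
    then show "P \<in> (\<Union>T\<in>\<T>. \<Union>x\<in>(S1 \<union> g T) - T. {P \<in> perm_graphs n. insert x T \<subseteq> P})"
    proof -
      assume "\<exists>T\<in>\<T>. \<exists>x\<in>(S1 \<union> g T) - T. insert x T \<subseteq> S"
      then obtain T x where "T \<in> \<T>" "x \<in> (S1 \<union> g T) - T" "insert x T \<subseteq> S" by blast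
      moreover have "P \<in> perm_graphs n" using P A by blast
      ultimately show ?thesis using S(2) by (intro UN_I[of T] UN_I[of x]) auto
    qed
  qed
  then have "card A \<le> card (\<Union>T\<in>\<T>. \<Union>x\<in>(S1 \<union> g T) - T. {P \<in> perm_graphs n. insert x T \<subseteq> P})"
    using fT fE finite_perm_graphs by (intro card_mono) auto
  also have "\<dots> \<le> (\<Sum>T\<in>\<T>. card (\<Union>x\<in>(S1 \<union> g T) - T. {P \<in> perm_graphs n. insert x T \<subseteq> P}))"
    using fT by (rule card_UN_le)
  also have "\<dots> \<le> (\<Sum>T\<in>\<T>. \<Sum>x\<in>(S1 \<union> g T) - T. card {P \<in> perm_graphs n. insert x T \<subseteq> P})"
    using fE by (intro sum_mono card_UN_le) auto
  also have "\<dots> \<le> (\<Sum>T\<in>\<T>. \<Sum>x\<in>(S1 \<union> g T) - T. fact (n - t - 1))"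
  proof (intro sum_mono)
    fix T x assume T: "T \<in> \<T>" and x: "x \<in> (S1 \<union> g T) - T"
    have "finite T" using T gen[OF S1] finite_subset by (auto simp: \<T>_def)
    then have "card (insert x T) = Suc t" using T x by (simp add: \<T>_def)
    then show "card {P \<in> perm_graphs n. insert x T \<subseteq> P} \<le> fact (n - t - 1)"
      using card_perm_graphs_containing_le[of n "insert x T"] by simp
  qed
  also have "\<dots> \<le> (\<Sum>T\<in>\<T>. 2 * q * fact (n - t - 1))"
  proof (rule sum_mono)
    fix T assume T: "T \<in> \<T>"
    have "card ((S1 \<union> g T) - T) \<le> card (S1 \<union> g T)"
      using gen[OF S1] gen[OF g(1)[OF T]] by (intro card_mono) auto
    also have "\<dots> \<le> card S1 + card (g T)" by (rule card_Un_le)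
    also have "\<dots> \<le> 2 * q" using gen[OF S1] gen[OF g(1)[OF T]] by simp
    finally show "(\<Sum>x\<in>(S1 \<union> g T) - T. fact (n - t - 1)) \<le> 2 * q * fact (n - t - 1)" by simp
  qed
  also have "\<dots> = card \<T> * (2 * q * fact (n - t - 1))" by simp
  also have "\<dots> \<le> 2 ^ q * (2 * q * fact (n - t - 1))"
  proof (rule mult_right_mono)
    have "card \<T> \<le> card (Pow S1)" using gen[OF S1] by (intro card_mono) (auto simp: \<T>_def)
    also have "\<dots> \<le> 2 ^ q" using gen[OF S1] by (simp add: card_Pow power_increasing)
    finally show "card \<T> \<le> 2 ^ q" .
  qed simp
  finally show ?thesis by (simp add: mult_ac)
qed simp

section \<open>Choice of parameters\<close>

text \<open>
  All size conditions hold for large \<open>n\<close> with \<open>b\<close> the \<open>M\<close>-th root of \<open>n\<close>, \<open>R = n / b\<close>, \<open>l\<close> about \<open>b / 2\<close> and \<open>j\<close>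
  about \<open>b\<^sup>2\<close>. The exponential \<open>(5/4) ^ l\<close> beats any power of \<open>n\<close>. In the first round \<open>2 ^ j\<close> beats
  \<open>exp (8 b)\<close>. In the second round the error is of order \<open>b ^ (2 m) * b\<^sup>2 / R\<close> under the root, which
  tends to zero because \<open>R = b ^ (2 m + 4)\<close>.
\<close>

lemma parameters_for_large_n:
  fixes m q C :: nat
  defines "M \<equiv> 2 * m + 5"
  shows "\<exists>n0. \<forall>n\<ge>n0. \<exists>b R l j. 36 \<le> b \<and> b \<le> real n \<and> real n = b ^ M \<and> R * b = real n \<and>
    2 * real l \<le> b \<and> 6 * l \<le> n \<and> l > 0 \<and> (5/4) ^ l > 2 * real n ^ (C + 2 * m) \<and>
    2 * q + m + 2 * l \<le> n \<and> 2 * real q * b ^ (2 * m) \<le> R \<and> j > 0 \<and> 4 * real j \<le> R \<and>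
    2 * sqrt (2 * b ^ (2 * m) * (exp (2 * (4 / R) * real n) / 2 ^ j))
        + sqrt (2 * (2 * b ^ (2 * m)) * exp 1 * 4 * real j / R) < 1 / 2"
proof -
  have "eventually (\<lambda>b::real. 36 \<le> b \<and> 3 * b \<le> b ^ M \<and>
     2 * (b ^ M) ^ (C + 2 * m) < (5/4) powr (b / 2 - 1) \<and>
     2 * real q + real m + b \<le> b ^ M \<and> 2 * real q * b ^ (2 * m) \<le> b ^ (2 * m + 4) \<and>
     4 * (b\<^sup>2 + 1) \<le> b ^ (2 * m + 4) \<and>
     2 * sqrt (2 * b ^ (2 * m) * (exp (8 * b) / 2 powr b\<^sup>2)) < 1 / 4 \<and>
     sqrt (2 * (2 * b ^ (2 * m)) * exp 1 * 4 * (b\<^sup>2 + 1) / b ^ (2 * m + 4)) < 1 / 4) at_top"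
    unfolding M_def by (intro eventually_conj; real_asymp)
  then obtain b0 where b0: "\<And>b::real. b \<ge> b0 \<Longrightarrow> 36 \<le> b \<and> 3 * b \<le> b ^ M \<and>
     2 * (b ^ M) ^ (C + 2 * m) < (5/4) powr (b / 2 - 1) \<and>
     2 * real q + real m + b \<le> b ^ M \<and> 2 * real q * b ^ (2 * m) \<le> b ^ (2 * m + 4) \<and>
     4 * (b\<^sup>2 + 1) \<le> b ^ (2 * m + 4) \<and>
     2 * sqrt (2 * b ^ (2 * m) * (exp (8 * b) / 2 powr b\<^sup>2)) < 1 / 4 \<and>
     sqrt (2 * (2 * b ^ (2 * m)) * exp 1 * 4 * (b\<^sup>2 + 1) / b ^ (2 * m + 4)) < 1 / 4"
    unfolding eventually_at_top_linorder by blast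
  have M: "M > 0" "M = Suc (2 * m + 4)" by (simp_all add: M_def)
  show ?thesis
  proof (intro exI[of _ "nat \<lceil>\<bar>b0\<bar> ^ M\<rceil>"] allI impI)
    fix n assume n: "nat \<lceil>\<bar>b0\<bar> ^ M\<rceil> \<le> n"
    define b where "b = root M (real n)"
    define R where "R = b ^ (2 * m + 4)"
    define l where "l = nat \<lfloor>b / 2\<rfloor>"
    define j where "j = nat \<lceil>b\<^sup>2\<rceil>"
    have nb: "real n = b ^ M" using M by (simp add: b_def)
    have "\<bar>b0\<bar> ^ M \<le> real n" using n by linarith
    then have "root M (\<bar>b0\<bar> ^ M) \<le> b" using M unfolding b_def by (simp only: real_root_le_iff)
    then have "b0 \<le> b" using M by (simp add: real_root_power_cancel)
    from b0[OF this] have b36: "36 \<le> b" and b3: "3 * b \<le> b ^ M"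
      and b54: "2 * (b ^ M) ^ (C + 2 * m) < (5/4) powr (b / 2 - 1)"
      and bq: "2 * real q + real m + b \<le> b ^ M" "2 * real q * b ^ (2 * m) \<le> b ^ (2 * m + 4)"
      and bj: "4 * (b\<^sup>2 + 1) \<le> b ^ (2 * m + 4)"
      and bs: "2 * sqrt (2 * b ^ (2 * m) * (exp (8 * b) / 2 powr b\<^sup>2)) < 1 / 4"
        "sqrt (2 * (2 * b ^ (2 * m)) * exp 1 * 4 * (b\<^sup>2 + 1) / b ^ (2 * m + 4)) < 1 / 4"
      by blast+
    have Rb: "R * b = real n" by (simp only: R_def nb M(2) power_Suc2)
    have R0: "R > 0" using b36 by (simp add: R_def)
    have l: "2 * real l \<le> b" "b / 2 - 1 \<le> real l" "l > 0"
      using b36 unfolding l_def by linarith+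
    have j: "b\<^sup>2 \<le> real j" "real j \<le> b\<^sup>2 + 1"
      unfolding j_def using zero_le_power2[of b] by linarith+
    have "b\<^sup>2 > 0" using b36 by simp
    then have j0: "j > 0" using j(1) by (cases j) auto
    have "(5/4::real) powr (b / 2 - 1) \<le> (5/4) powr real l" using l(2) by (intro powr_mono) auto
    also have "\<dots> = (5/4) ^ l" by (simp add: powr_realpow)
    finally have l54: "2 * real n ^ (C + 2 * m) < (5/4) ^ l" using b54 unfolding nb by linarith
    have "4 / R * real n = 4 * b" unfolding Rb[symmetric] using R0 by simp
    then have "2 * (4 / R) * real n = 8 * b" by linarith
    then have e: "exp (2 * (4 / R) * real n) = exp (8 * b)" by simp
    have "(2::real) powr b\<^sup>2 \<le> 2 powr real j" using j(1) by (intro powr_mono) auto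
    also have "\<dots> = 2 ^ j" by (simp add: powr_realpow)
    finally have "exp (8 * b) / 2 ^ j \<le> exp (8 * b) / 2 powr b\<^sup>2" by (intro divide_left_mono) auto
    then have "2 * sqrt (2 * b ^ (2 * m) * (exp (8 * b) / 2 ^ j))
      \<le> 2 * sqrt (2 * b ^ (2 * m) * (exp (8 * b) / 2 powr b\<^sup>2))"
      using b36 by (intro mult_left_mono real_sqrt_le_mono) auto
    then have s1: "2 * sqrt (2 * b ^ (2 * m) * (exp (2 * (4 / R) * real n) / 2 ^ j)) < 1 / 4"
      unfolding e using bs(1) by linarith
    have "sqrt (2 * (2 * b ^ (2 * m)) * exp 1 * 4 * real j / R)
      \<le> sqrt (2 * (2 * b ^ (2 * m)) * exp 1 * 4 * (b\<^sup>2 + 1) / R)"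
      using j(2) R0 b36 by (intro real_sqrt_le_mono divide_right_mono mult_left_mono) auto
    then have s2: "sqrt (2 * (2 * b ^ (2 * m)) * exp 1 * 4 * real j / R) < 1 / 4"
      using bs(2) unfolding R_def by linarith
    have "6 * real l \<le> real n" "2 * real q + real m + 2 * real l \<le> real n"
      using l(1) b3 bq(1) unfolding nb by linarith+
    then have ln: "6 * l \<le> n" "2 * q + m + 2 * l \<le> n" by linarith+
    have bn: "b \<le> real n" using b3 b36 unfolding nb by linarith
    have "4 * real j \<le> 4 * (b\<^sup>2 + 1)" using j(2) by (intro mult_left_mono) auto
    then have jR: "4 * real j \<le> R" using bj unfolding R_def by (rule order_trans)
    have qR: "2 * real q * b ^ (2 * m) \<le> R" using bq(2) unfolding R_def .
    from s1 s2 have s12: "2 * sqrt (2 * b ^ (2 * m) * (exp (2 * (4 / R) * real n) / 2 ^ j))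
        + sqrt (2 * (2 * b ^ (2 * m)) * exp 1 * 4 * real j / R) < 1 / 2" by linarith
    show "\<exists>b R l j. 36 \<le> b \<and> b \<le> real n \<and> real n = b ^ M \<and> R * b = real n \<and>
    2 * real l \<le> b \<and> 6 * l \<le> n \<and> l > 0 \<and> (5/4) ^ l > 2 * real n ^ (C + 2 * m) \<and>
    2 * q + m + 2 * l \<le> n \<and> 2 * real q * b ^ (2 * m) \<le> R \<and> j > 0 \<and> 4 * real j \<le> R \<and>
    2 * sqrt (2 * b ^ (2 * m) * (exp (2 * (4 / R) * real n) / 2 ^ j))
        + sqrt (2 * (2 * b ^ (2 * m)) * exp 1 * 4 * real j / R) < 1 / 2"
      by (intro exI[of _ b] exI[of _ R] exI[of _ l] exI[of _ j] conjI
        b36 bn nb Rb l ln l54 qR j0 jR s12)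
  qed
qed

section \<open>The structure of large families with a forbidden intersection size\<close>

text \<open>
  The theorem in terms of graphs, for large \<open>n\<close>: \<open>\<S>\<close> is the set of generators, and \<open>A'\<close> is
  the set of members that contain no generator. The density exponent \<open>C = r + q\<close> arises because a
  family with more than \<open>(n - r)!\<close> members has density at least \<open>n\<close> to the power \<open>-r\<close>, and passing to a
  spread subfamily loses at most \<open>R ^ q\<close>, hence at most \<open>n ^ q\<close>.
\<close>

lemma kernel_or_small:
  assumes t: "0 < t" "t < r"
  shows "\<exists>n0 K. \<forall>n\<ge>n0. \<forall>A\<subseteq>perm_graphs n. (\<forall>P\<in>A. \<forall>P'\<in>A. card (P \<inter> P') \<noteq> t - 1) \<longrightarrow>
    K * fact (n - t - 1) < card A \<longrightarrow>
    (\<exists>T. card T = t \<and> (\<exists>P\<in>perm_graphs n. T \<subseteq> P) \<and> card {P\<in>A. \<not> T \<subseteq> P} \<le> fact (n - r))"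
proof -
  define m where "m = t - 1"
  define M where "M = 2 * m + 5"
  define q where "q = r + 2 * r * M"
  define C where "C = r + q"
  define K where "K = 2 ^ q * (2 * q) + (1::nat)"
  obtain n0 where n0: "\<forall>n\<ge>n0. \<exists>b R l j. 36 \<le> b \<and> b \<le> real n \<and> real n = b ^ M \<and> R * b = real n \<and>
    2 * real l \<le> b \<and> 6 * l \<le> n \<and> l > 0 \<and> (5/4) ^ l > 2 * real n ^ (C + 2 * m) \<and>
    2 * q + m + 2 * l \<le> n \<and> 2 * real q * b ^ (2 * m) \<le> R \<and> j > 0 \<and> 4 * real j \<le> R \<and>
    2 * sqrt (2 * b ^ (2 * m) * (exp (2 * (4 / R) * real n) / 2 ^ j))
        + sqrt (2 * (2 * b ^ (2 * m)) * exp 1 * 4 * real j / R) < 1 / 2"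
    using parameters_for_large_n[where m = m and q = q and C = C] unfolding M_def by blast
  have "\<exists>T. card T = t \<and> (\<exists>P\<in>perm_graphs n. T \<subseteq> P) \<and> card {P\<in>A. \<not> T \<subseteq> P} \<le> fact (n - r)"
    if n: "max n0 (2 * r) \<le> n" and A: "A \<subseteq> perm_graphs n"
      and free: "\<forall>P\<in>A. \<forall>P'\<in>A. card (P \<inter> P') \<noteq> t - 1" and large: "K * fact (n - t - 1) < card A"
    for n A
  proof -
    from n have "n0 \<le> n" "2 * r \<le> n" by auto
    from n0[rule_format, OF this(1)] obtain b R l j where b: "36 \<le> b" "b \<le> real n" "real n = b ^ M" "R * b = real n"
      and l: "2 * real l \<le> b" "6 * l \<le> n" "l > 0" "(5/4) ^ l > 2 * real n ^ (C + 2 * m)"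
      and q: "2 * q + m + 2 * l \<le> n" "2 * real q * b ^ (2 * m) \<le> R"
      and j: "j > 0" "4 * real j \<le> R"
      and small: "2 * sqrt (2 * b ^ (2 * m) * (exp (2 * (4 / R) * real n) / 2 ^ j))
        + sqrt (2 * (2 * b ^ (2 * m)) * exp 1 * 4 * real j / R) < 1 / 2" by blast
    have npos: "n > 0" using \<open>2 * r \<le> n\<close> t by simp
    have R0: "R > 0" using j by (meson less_le_trans of_nat_0_less_iff mult_pos_pos zero_less_numeral)
    have Rn: "R \<le> real n" using b(1,4) R0 by (metis mult_left_mono mult.right_neutral less_imp_le order_trans one_le_numeral)
    have fA: "finite A" using A finite_perm_graphs finite_subset by blast
    define \<S> where "\<S> = {S. finite S \<and> card S \<le> q \<and>
      (\<exists>B\<subseteq>A. spread_over R S B \<and> fact n \<le> real (card B) * real n ^ C)}"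
    have inter: "t \<le> card (S \<inter> S')" if S: "S \<in> \<S>" "S' \<in> \<S>" for S S'
    proof (rule ccontr)
      assume "\<not> ?thesis"
      then have le: "card (S \<inter> S') \<le> m" by (simp add: m_def)
      obtain B where B: "B \<subseteq> A" "spread_over R S B" "fact n \<le> real (card B) * real n ^ C"
        and fS: "finite S" "card S \<le> q" using S(1) by (auto simp: \<S>_def)
      obtain B' where B': "B' \<subseteq> A" "spread_over R S' B'" "fact n \<le> real (card B') * real n ^ C"
        and fS': "finite S'" "card S' \<le> q" using S(2) by (auto simp: \<S>_def)
      have b1: "1 \<le> b" using b(1) by simp
      obtain P P' where "P \<in> B" "P' \<in> B'" "card (P \<inter> P') = m"
        by (rule obtain_exact_intersection[OF subset_trans[OF B(1) A] B(3,2) subset_trans[OF B'(1) A] B'(3,2)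
            fS(1) fS'(1) fS(2) fS'(2) le npos b1 b(2,4) l q j small])
      then show False using free B(1) B'(1) unfolding m_def by blast
    qed
    define A' where "A' = {P\<in>A. \<forall>S\<in>\<S>. \<not> S \<subseteq> P}"
    have A'small: "card A' \<le> fact (n - r)"
    proof (rule ccontr)
      assume "\<not> ?thesis"
      then have gt: "fact (n - r) < card A'" by simp
      have fA': "finite A'" using fA by (simp add: A'_def)
      have ne: "A' \<noteq> {}" using gt by (metis card.empty not_less0)
      have finP: "finite P" if "P \<in> A'" for P using that A perm_graphsD(2) by (auto simp: A'_def)
      obtain S where S: "spread_over R S {P\<in>A'. S \<subseteq> P}" "{P\<in>A'. S \<subseteq> P} \<noteq> {}"
        and le: "real (card A') \<le> real (card {P\<in>A'. S \<subseteq> P}) * R ^ card S"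
        by (rule obtain_spread_restriction[OF fA' ne finP R0])
      define B where "B = {P\<in>A'. S \<subseteq> P}"
      obtain P where P: "P \<in> A'" "S \<subseteq> P" using S(2) by blast
      have Pn: "P \<in> perm_graphs n" using P A by (auto simp: A'_def)
      have fS: "finite S" "card S \<le> n"
        using perm_graphsD(2,3)[OF Pn] P(2) finite_subset card_mono by blast+
      have "real (fact (n - r)) \<le> real (card A')" using gt by (intro of_nat_mono) simp
      then have le': "fact (n - r) \<le> real (card B) * R ^ card S" using le by (simp add: B_def)
      have "card B \<le> card {P \<in> perm_graphs n. S \<subseteq> P}"
        using A finite_perm_graphs by (intro card_mono) (auto simp: B_def A'_def)
      also have "\<dots> \<le> fact (n - card S)" by (rule card_perm_graphs_containing_le)
      finally have "real (card B) \<le> fact (n - card S)" by (metis of_nat_fact of_nat_le_iff)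
      then have "real (card B) * R ^ card S \<le> fact (n - card S) * R ^ card S"
        using R0 by (intro mult_right_mono) auto
      with le' have "fact (n - r) \<le> fact (n - card S) * R ^ card S" by linarith
      from restriction_size_le[OF b(1,3,4) \<open>2 * r \<le> n\<close> fS(2) this]
      have Sq: "card S \<le> q" by (simp add: q_def)
      have "fact n \<le> real n ^ r * fact (n - r)"
      proof -
        have "fact n = fact (n - r) * (fact n div fact (n - r) :: nat)"
          by (simp add: fact_dvd)
        also have "\<dots> \<le> fact (n - r) * n ^ r"
          using \<open>2 * r \<le> n\<close> by (intro mult_left_mono fact_div_fact_le_pow) auto
        finally have "real (fact n) \<le> real (fact (n - r) * n ^ r)" by (rule of_nat_mono)
        then show ?thesis by (simp add: mult.commute)
      qed
      also have "\<dots> \<le> real n ^ r * (real (card B) * R ^ card S)" using le' by (intro mult_left_mono) auto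
      also have "\<dots> \<le> real n ^ r * (real (card B) * real n ^ q)"
      proof -
        have "R ^ card S \<le> real n ^ card S" using R0 Rn by (intro power_mono) auto
        also have "\<dots> \<le> real n ^ q" using npos Sq by (intro power_increasing) auto
        finally show ?thesis by (intro mult_left_mono) auto
      qed
      also have "\<dots> = real (card B) * real n ^ C" by (simp add: C_def power_add)
      finally have dense: "fact n \<le> real (card B) * real n ^ C" .
      have "B \<subseteq> A" by (auto simp: B_def A'_def)
      then have "S \<in> \<S>" using fS Sq dense S(1) unfolding \<S>_def B_def by blast
      then show False using P by (auto simp: A'_def)
    qed
    have fact_le: "fact (n - r) \<le> (fact (n - t - 1) :: nat)" using t by (intro fact_mono) simp
    show ?thesis
    proof (cases "\<exists>T. finite T \<and> card T = t \<and> (\<forall>S\<in>\<S>. T \<subseteq> S)")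
      case True
      then obtain T where T: "card T = t" "\<forall>S\<in>\<S>. T \<subseteq> S" by blast
      have "\<S> \<noteq> {}"
      proof
        assume "\<S> = {}"
        then have "A' = A" by (auto simp: A'_def)
        then have "card A \<le> fact (n - t - 1)" using A'small fact_le by simp
        also have "\<dots> \<le> K * fact (n - t - 1)" by (simp add: K_def)
        finally show False using large by simp
      qed
      then obtain S B where S: "S \<in> \<S>" "B \<subseteq> A" "spread_over R S B" "fact n \<le> real (card B) * real n ^ C"
        by (auto simp: \<S>_def)
      have "B \<noteq> {}" using S(4) by (metis card.empty fact_gt_zero mult_zero_left not_less of_nat_0)
      then obtain P where "P \<in> B" by blast
      then have "P \<in> perm_graphs n" "S \<subseteq> P" using S A by (auto simp: spread_over_def)
      moreover have "T \<subseteq> S" using T S by blast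
      moreover have "card {P\<in>A. \<not> T \<subseteq> P} \<le> card A'"
        using fA T(2) by (intro card_mono) (auto simp: A'_def)
      ultimately show ?thesis using T(1) A'small by (intro exI[of _ T]) auto
    next
      case False
      have "card (A - A') \<le> 2 ^ q * (2 * q) * fact (n - t - 1)"
      proof (rule card_covered_by_intersecting_generators_le)
        show "finite S \<and> card S \<le> q" if "S \<in> \<S>" for S using that by (auto simp: \<S>_def)
        show "t \<le> card (S \<inter> S')" if "S \<in> \<S>" "S' \<in> \<S>" for S S' using that by (rule inter)
        show "\<exists>S\<in>\<S>. \<not> T \<subseteq> S" if "finite T" "card T = t" for T using False that by blast
        show "A - A' \<subseteq> perm_graphs n" using A by auto
        show "\<exists>S\<in>\<S>. S \<subseteq> P" if "P \<in> A - A'" for P using that by (auto simp: A'_def)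
      qed
      moreover have "card A \<le> card (A - A') + card A'"
      proof -
        have "A = (A - A') \<union> A'" by (auto simp: A'_def)
        then show ?thesis by (metis card_Un_le)
      qed
      ultimately have "card A \<le> K * fact (n - t - 1)"
        using A'small fact_le unfolding K_def distrib_right by linarith
      then show ?thesis using large by simp
    qed
  qed
  then show ?thesis by (intro exI[of _ "max n0 (2 * r)"] exI[of _ K] allI impI)
qed

lemma ext_fact_ge_1: "1 \<le> ext_fact k"
  by (simp add: ext_fact_def)

lemma ext_fact_diff: "k \<le> n \<Longrightarrow> ext_fact (int n - int k) = fact (n - k)"
  by (simp add: ext_fact_def nat_diff_distrib)

theorem theorem1p3:
  fixes r t :: nat
  assumes "r > t"
  shows "\<exists>K::real. K > 0 \<and>
    (\<forall>(n::nat) F. F \<subseteq> Sym n \<longrightarrow> intersection_free n (int t - 1) F \<longrightarrow>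
       real (card F) \<ge> K * ext_fact (int n - int t - 1) \<longrightarrow>
       (\<exists>G. is_star n t G \<and> real (card (F - G)) \<le> K * ext_fact (int n - int r)))"
proof (cases "t = 0")
  case True
  have star: "is_star n 0 (Sym n)" for n
    unfolding is_star_def by (intro exI[of _ "{}"] exI[of _ id]) auto
  show ?thesis
  proof (intro exI[of _ 1] conjI allI impI)
    fix n F assume "F \<subseteq> Sym n"
    then have "card (F - Sym n) = 0" by (metis Diff_eq_empty_iff card.empty)
    then show "\<exists>G. is_star n t G \<and> real (card (F - G)) \<le> 1 * ext_fact (int n - int r)"
      using star ext_fact_ge_1[of "int n - int r"] True by (intro exI[of _ "Sym n"]) auto
  qed simp
next
  case False
  then have t: "0 < t" "t < r" using assms by auto
  from kernel_or_small[OF t] obtain n0 K0 where main: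
    "\<forall>n\<ge>n0. \<forall>A\<subseteq>perm_graphs n. (\<forall>P\<in>A. \<forall>P'\<in>A. card (P \<inter> P') \<noteq> t - 1) \<longrightarrow>
    K0 * fact (n - t - 1) < card A \<longrightarrow>
    (\<exists>T. card T = t \<and> (\<exists>P\<in>perm_graphs n. T \<subseteq> P) \<and> card {P\<in>A. \<not> T \<subseteq> P} \<le> fact (n - r))" by blast
  \<comment> \<open>With K > fact N the hypothesis on the size of F is void for n up to N.\<close>
  define N where "N = max n0 r"
  define K where "K = real K0 + fact N + 1"
  have K: "K \<ge> 1" "K > real K0" "K > fact N"
    using fact_gt_zero[of N, where ?'a = real] by (simp_all add: K_def add_pos_nonneg del: fact_gt_zero)
  show ?thesis
  proof (intro exI[of _ K] conjI allI impI)
    show "K > 0" using K(1) by simp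
    fix n F assume F: "F \<subseteq> Sym n" and free: "intersection_free n (int t - 1) F"
      and large: "K * ext_fact (int n - int t - 1) \<le> real (card F)"
    have injF: "inj_on (graph n) F" using inj_on_graph F by (rule inj_on_subset)
    have "card F \<le> card (Sym n)" using F finite_Sym by (intro card_mono)
    also have "\<dots> = fact n" unfolding Sym_def by (rule card_permutations) auto
    finally have "real (card F) \<le> fact n" by (metis of_nat_fact of_nat_le_iff)
    moreover have "K * 1 \<le> K * ext_fact (int n - int t - 1)"
      using K(1) ext_fact_ge_1 by (intro mult_left_mono) auto
    ultimately have "(fact N :: real) < fact n" using large K(3) by linarith
    then have "N < n" by (metis fact_mono not_less)
    then have n: "n0 \<le> n" "r \<le> n" by (auto simp: N_def)
    define A where "A = graph n ` F"
    have A: "A \<subseteq> perm_graphs n" using F by (auto simp: A_def perm_graphs_def)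
    have cA: "card A = card F" using injF by (simp add: A_def card_image)
    have "\<exists>T. card T = t \<and> (\<exists>P\<in>perm_graphs n. T \<subseteq> P) \<and> card {P\<in>A. \<not> T \<subseteq> P} \<le> fact (n - r)"
    proof (rule main[rule_format, OF n(1) A])
      show "card (P \<inter> P') \<noteq> t - 1" if P: "P \<in> A" "P' \<in> A" for P P'
      proof
        assume eq: "card (P \<inter> P') = t - 1"
        obtain \<sigma> \<tau> where s: "\<sigma> \<in> F" "\<tau> \<in> F" "P = graph n \<sigma>" "P' = graph n \<tau>"
          using P by (auto simp: A_def)
        have "int (card {i \<in> {1..n}. \<sigma> i = \<tau> i}) = int t - 1"
          using eq t unfolding s card_graph_Int by simp
        then have "\<sigma> = \<tau>" using free s unfolding intersection_free_def by blast
        then have "card P = t - 1" using eq s by simp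
        moreover have "card P = n" using perm_graphsD(3) P A by blast
        ultimately show False using n t by simp
      qed
      show "K0 * fact (n - t - 1) < card A"
      proof -
        have "ext_fact (int n - int (t + 1)) = fact (n - (t + 1))" using n t by (intro ext_fact_diff) simp
        then have e: "ext_fact (int n - int t - 1) = fact (n - t - 1)" by (simp add: algebra_simps)
        have "real (K0 * fact (n - t - 1)) < K * fact (n - t - 1)" using K(2) by simp
        also have "\<dots> \<le> real (card A)" using large cA e by simp
        finally show ?thesis by (simp only: of_nat_less_iff)
      qed
    qed
    then obtain T P where T: "card T = t" "P \<in> perm_graphs n" "T \<subseteq> P"
      and rest: "card {P\<in>A. \<not> T \<subseteq> P} \<le> fact (n - r)" by (elim exE conjE bexE)
    obtain \<pi> where pi: "\<pi> permutes {1..n}" "P = graph n \<pi>" using T(2) by (auto simp: perm_graphs_def Sym_def)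
    define S where "S = fst ` T"
    have Tpi: "p \<in> T \<Longrightarrow> fst p \<in> {1..n} \<and> snd p = \<pi> (fst p)" for p
      using T(3) by (auto simp: pi(2) graph_def)
    have S: "S \<subseteq> {1..n}" using Tpi by (auto simp: S_def)
    have "inj_on fst T" using Tpi by (metis inj_onI prod_eqI)
    then have cS: "card S = t" using T(1) by (simp add: S_def card_image)
    have inj: "inj_on \<pi> S" using permutes_inj[OF pi(1)] by (rule inj_on_subset) simp
    define G where "G = {\<sigma> \<in> Sym n. \<forall>j\<in>S. \<sigma> j = \<pi> j}"
    have "is_star n t G"
      unfolding is_star_def G_def
    proof (intro exI conjI)
      show "S \<subseteq> {1..n}" "card S = t" by fact+
      show "\<pi> ` S \<subseteq> {1..n}" using S permutes_in_image[OF pi(1)] by blast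
      show "card (\<pi> ` S) = t" using cS inj by (simp add: card_image)
      show "bij_betw \<pi> S (\<pi> ` S)" using inj by (rule inj_on_imp_bij_betw)
    qed simp
    moreover have "real (card (F - G)) \<le> K * ext_fact (int n - int r)"
    proof -
      have "graph n ` (F - G) \<subseteq> {P\<in>A. \<not> T \<subseteq> P}"
      proof (rule image_subsetI)
        fix \<sigma> assume s: "\<sigma> \<in> F - G"
        have "\<not> T \<subseteq> graph n \<sigma>"
        proof
          assume sub: "T \<subseteq> graph n \<sigma>"
          have "\<sigma> j = \<pi> j" if j: "j \<in> S" for j
          proof -
            obtain v where v: "(j, v) \<in> T" using j by (auto simp: S_def)
            then have "(j, v) \<in> graph n \<sigma>" using sub by blast
            then show ?thesis using Tpi[OF v] by (simp add: mem_graph_iff)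
          qed
          then show False using s F by (auto simp: G_def)
        qed
        then show "graph n \<sigma> \<in> {P\<in>A. \<not> T \<subseteq> P}" using s by (auto simp: A_def)
      qed
      moreover have "finite {P\<in>A. \<not> T \<subseteq> P}"
        using finite_subset[OF F finite_Sym] by (simp add: A_def)
      ultimately have "card (graph n ` (F - G)) \<le> card {P\<in>A. \<not> T \<subseteq> P}" by (rule card_mono[rotated])
      also have "\<dots> \<le> fact (n - r)" by (rule rest)
      finally have "card (F - G) \<le> fact (n - r)"
        using card_image[OF inj_on_subset[OF injF, of "F - G"]] by simp
      then have "real (card (F - G)) \<le> real (fact (n - r))" by (rule of_nat_mono)
      then have "real (card (F - G)) \<le> 1 * fact (n - r)" by simp
      also have "\<dots> \<le> K * fact (n - r)" using K(1) by (intro mult_right_mono) auto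
      also have "\<dots> = K * ext_fact (int n - int r)" using n by (simp add: ext_fact_diff)
      finally show ?thesis .
    qed
    ultimately show "\<exists>G. is_star n t G \<and> real (card (F - G)) \<le> K * ext_fact (int n - int r)" by blast
  qed
qed

end
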